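(* Define integers $\overline{u2}(n)$ and $u2(n)$ for $n\in\mathbb{N}_0$ by the power series expansions (for $|q|<1$) \[ \sum_{n\ge0}\overline{u2}(n)q^n:=\sum_{n\ge1}\frac{\left(-q^2;q^2\right)_{n-1}^2q^{2n}}{(q;-q)_{2n}},\qquad \sum_{n\ge0}u2(n)q^n:=\sum_{n\ge1}\frac{\left(-q^2;q^2\right)_{n-1}^2q^{2n}}{\left(q;q^2\right)_{n}} . \] Then, as $n\to\infty$, \[ \overline{u2}(n)\sim \frac{1}{8(2n)^{\frac34}}e^{\pi\sqrt{\frac n2}},\qquad u2(n)\sim\frac{1}{4\sqrt3\,(6n)^{\frac34}}e^{\pi\sqrt{\frac{2n}{3}}}. \]
   Context: For $n\in\mathbb{N}_0\cup\{\infty\}$, $(a;q)_n:=\prod_{j=0}^{n-1}(1-aq^j)$ (the $q$-Pochhammer symbol). The two series above are $\overline{U2}(1;-q)$ and $U2(1;-q)$, where $\overline{U2}(\zeta;q):=\sum_{n\ge1}\frac{(-\zeta q^2,-\zeta^{-1}q^2;q^2)_{n-1}q^{2n}}{(-q;q)_{2n}}$ and $U2(\zeta;q):=\sum_{n\ge1}\frac{(-\zeta q^2,-\zeta^{-1}q^2;q^2)_{n-1}q^{2n}}{(-q;q^2)_{n}}$, with $(a_1,\dots,a_k;q)_n:=(a_1;q)_n\cdots(a_k;q)_n$. *)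

theory Defs
  imports Complex_Main "HOL-Library.Landau_Symbols"
begin

definition qpochhammer :: "'a \<Rightarrow> 'a \<Rightarrow> nat \<Rightarrow> 'a :: comm_ring_1" where
  "qpochhammer a q n = (\<Prod>j<n. 1 - a * q ^ j)"

definition u2bar_term :: "nat \<Rightarrow> complex \<Rightarrow> complex" where
  "u2bar_term n q =
     (qpochhammer (- (q ^ 2)) (q ^ 2) (n - 1)) ^ 2 * q ^ (2 * n) / qpochhammer q (- q) (2 * n)"

definition u2_term :: "nat \<Rightarrow> complex \<Rightarrow> complex" where
  "u2_term n q =
     (qpochhammer (- (q ^ 2)) (q ^ 2) (n - 1)) ^ 2 * q ^ (2 * n) / qpochhammer q (q ^ 2) n"

(* sum_{n>=0} u(n) q^n = sum_{n>=1} t_n(q) for all complex q with |q| < 1. Both series are required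
   to converge. The index shift Suc makes the right-hand series start at n = 1. *)
definition has_power_series_coeffs ::
  "(nat \<Rightarrow> complex \<Rightarrow> complex) \<Rightarrow> (nat \<Rightarrow> int) \<Rightarrow> bool" where
  "has_power_series_coeffs t u \<longleftrightarrow>
     (\<forall>q. norm q < 1 \<longrightarrow>
        (\<exists>S. (\<lambda>n. t (Suc n) q) sums S \<and> (\<lambda>n. of_int (u n) * q ^ n) sums S))"

definition u2bar :: "nat \<Rightarrow> int" where
  "u2bar = (THE u. has_power_series_coeffs u2bar_term u)"

definition u2 :: "nat \<Rightarrow> int" where
  "u2 = (THE u. has_power_series_coeffs u2_term u)"

end

theory Submission
  imports Defs "HOL-Probability.Probability" "HOL-Real_Asymp.Real_Asymp"
begin

text \<open>
  Put $x_m = q^{2m+2}$, let $a = 1$ for the first series and $a = 2$ for the second, and let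
  $S_m = \prod_{1 \leq j \le m} (1+q^{2j})^a / \prod_{j \leq m} (1-q^{2j+1})$, with limit $P$. Since
  $S_{m+1} - S_m = S_m x_m (a + q + (a-1) x_m) / (1 - x_m q)$ telescopes to $P - S_0$, the series
  $K = \sum_m S_m x_m / (1 - x_m q)$ satisfies $(a+1) K \approx P$, the error being governed by
  $K_2 = \sum_m S_m x_m^2 / (1 - x_m q)$ and by $(1-q^2) K$. Telescoping $S_m x_m$ gives
  $(1-q^2) K = q^2/(1-q) + q K_2 + \dots$, where all terms have nondecreasing coefficients.
  So the differences of the coefficients of $K$ are nondecreasing, which makes them, and with them
  the coefficients of $K_2$, of smaller order than those of $P$, as soon as consecutive coefficients
  of $P$ have ratio tending to $1$. Both series of the theorem differ from $K$ by at most a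
  multiple of $K_2$, so their coefficients are asymptotic to those of $P / (a+1)$.

  The coefficients of $P$ are found by the saddle point method. The product
  $\prod_j (1+e^{-jz})$ is $\exp(\pi^2/(12z) - \frac12 \log 2 + O(|z|))$ in a sector, by the trapezoid
  rule for $\log(1+e^{-w})$, whose antiderivative is a dilogarithm, and $P$ consists of such
  products by Euler's identity. With $t = \sqrt{A/n}$ and $z = t + i t^{3/2} v$ Cauchy's integral
  becomes Gaussian in the limit, by dominated convergence.
\<close>

section \<open>Generating functions with nonnegative coefficients\<close>

text \<open>Neither series is given as a product, so no estimate near q = 1 reaches its coefficients
  directly: knowing that K behaves like P/(a+1) as q tends to 1 would control only averages of
  coefficients. The missing regularity comes from the factor 1/(1-q) of S_m together with the second
  telescoping: one large increment of K would force all later ones to be large, and K would outgrow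
  P. Only P has to be treated analytically. For P the obstacle is the circle away from the real
  axis. The expansion of log P is available only in a sector of z, while q = -1 makes the even
  factors 1 + q^(2j) as large as q = 1 does. The odd factors 1/(1 - q^(2j+1)) decide: comparing them
  with their values at |q| gives one bound on the whole segment |Im z| \<le> pi, strong enough to
  serve as the dominating function, so the integral is never split into arcs. All formal identities
  are between finite sums; the coefficient of q^N in a truncation is final from index N on.\<close>

definition fps_nonneg :: "int fps \<Rightarrow> bool" where
  "fps_nonneg A \<longleftrightarrow> (\<forall>n. 0 \<le> fps_nth A n)"

text \<open>Multiplication by 1 - X takes differences of consecutive coefficients and keeps the
  constant one. The sign of the constant coefficient is thus included, which makes the property
  stable under products with nonnegative series.\<close>

definition fps_incr :: "int fps \<Rightarrow> bool" where
  "fps_incr A \<longleftrightarrow> fps_nonneg ((1 - fps_X) * A)"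

text \<open>For m > 0 the inverse of 1 - X^m, given by its coefficients so that nonnegativity is
  immediate.\<close>

definition fps_geo :: "nat \<Rightarrow> int fps" where
  "fps_geo m = Abs_fps (\<lambda>n. of_bool (m dvd n))"

lemma fps_nonneg_mult: "fps_nonneg A \<Longrightarrow> fps_nonneg B \<Longrightarrow> fps_nonneg (A * B)"
  by (auto simp: fps_nonneg_def fps_mult_nth intro!: sum_nonneg)

lemma fps_nonneg_add: "fps_nonneg A \<Longrightarrow> fps_nonneg B \<Longrightarrow> fps_nonneg (A + B)"
  by (auto simp: fps_nonneg_def)

lemma fps_nonneg_sum: "(\<And>m. m \<in> I \<Longrightarrow> fps_nonneg (f m)) \<Longrightarrow> fps_nonneg (sum f I)"
  by (auto simp: fps_nonneg_def fps_sum_nth intro!: sum_nonneg)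

lemma fps_nonneg_one [simp]: "fps_nonneg 1"
  by (auto simp: fps_nonneg_def)

lemma fps_nonneg_X [simp]: "fps_nonneg fps_X"
  by (auto simp: fps_nonneg_def fps_X_def)

lemma fps_nonneg_of_nat [simp]: "fps_nonneg (of_nat n)"
  by (auto simp: fps_nonneg_def fps_of_nat [symmetric])

lemma fps_nonneg_power: "fps_nonneg A \<Longrightarrow> fps_nonneg (A ^ n)"
  by (induction n) (auto intro: fps_nonneg_mult)

lemma fps_nonneg_geo [simp]: "fps_nonneg (fps_geo m)"
  by (auto simp: fps_nonneg_def fps_geo_def)

lemmas fps_nonneg_intros = fps_nonneg_mult fps_nonneg_add fps_nonneg_sum fps_nonneg_power
  fps_nonneg_one fps_nonneg_X fps_nonneg_of_nat fps_nonneg_geo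

lemma fps_geo_mult: "m > 0 \<Longrightarrow> fps_geo m * (1 - fps_X ^ m) = 1"
proof (rule fps_ext)
  fix n assume m: "m > 0"
  have "n = 0" if "n < m" "m dvd n" using that by (metis dvd_imp_le not_gr0 not_less)
  moreover have "m dvd n - m \<longleftrightarrow> m dvd n" if "m \<le> n" using that by (simp add: dvd_minus_self)
  ultimately show "fps_nth (fps_geo m * (1 - fps_X ^ m)) n = fps_nth 1 n" using m
    by (auto simp: right_diff_distrib fps_X_power_mult_right_nth fps_geo_def)
qed

lemma fps_incr_geo_1: "fps_incr (fps_geo 1)"
  using fps_geo_mult[of 1] by (simp add: fps_incr_def mult.commute)

lemma fps_incr_mult: "fps_incr A \<Longrightarrow> fps_nonneg B \<Longrightarrow> fps_incr (A * B)"
  unfolding fps_incr_def by (metis fps_nonneg_mult mult.assoc)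

lemma fps_incr_mult': "fps_nonneg B \<Longrightarrow> fps_incr A \<Longrightarrow> fps_incr (B * A)"
  using fps_incr_mult by (simp add: mult.commute)

lemma fps_incr_add: "fps_incr A \<Longrightarrow> fps_incr B \<Longrightarrow> fps_incr (A + B)"
  unfolding fps_incr_def by (metis distrib_left fps_nonneg_add)

lemma fps_incr_sum: "(\<And>m. m \<in> I \<Longrightarrow> fps_incr (f m)) \<Longrightarrow> fps_incr (sum f I)"
  unfolding fps_incr_def by (auto simp: sum_distrib_left intro!: fps_nonneg_sum)

lemma fps_incr_nonneg: "fps_incr A \<Longrightarrow> fps_nonneg A"
proof -
  assume "fps_incr A"
  then have "fps_nonneg (fps_geo 1 * ((1 - fps_X) * A))"
    by (auto simp: fps_incr_def intro!: fps_nonneg_mult)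
  also have "fps_geo 1 * ((1 - fps_X) * A) = A"
    using fps_geo_mult[of 1] by (simp add: mult.assoc[symmetric])
  finally show ?thesis .
qed

lemma fps_incr_le_Suc: "fps_incr A \<Longrightarrow> fps_nth A n \<le> fps_nth A (Suc n)"
proof -
  assume "fps_incr A"
  then have "0 \<le> fps_nth ((1 - fps_X) * A) (Suc n)"
    by (auto simp: fps_incr_def fps_nonneg_def)
  then show ?thesis by (simp add: algebra_simps)
qed

lemma fps_incr_le: "fps_incr A \<Longrightarrow> m \<le> n \<Longrightarrow> fps_nth A m \<le> fps_nth A n"
  using lift_Suc_mono_le[of "fps_nth A"] fps_incr_le_Suc by blast

lemma fps_nth_mult_X_power_0: "n < m \<Longrightarrow> fps_nth (A * fps_X ^ m) n = 0"
  by (simp add: fps_X_power_mult_right_nth)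

text \<open>Lets a finite truncation stand for the infinite sum over m: summands that start beyond
  q^N do not reach the coefficient N.\<close>

lemma sum_fps_nth_stable:
  assumes "\<And>m. N \<le> m \<Longrightarrow> fps_nth (f m) N = 0" "N \<le> T"
  shows "fps_nth (\<Sum>m<T. f m) N = fps_nth (\<Sum>m<N. f m) N"
proof -
  have "(\<Sum>m<T. fps_nth (f m) N) = (\<Sum>m<N. fps_nth (f m) N)"
    using assms by (intro sum.mono_neutral_right) auto
  then show ?thesis by (simp add: fps_sum_nth)
qed

text \<open>\<open>Sfps a m * Xpow m\<close> is the summand with index $n = m + 1$, up to the factor $1/(1+q^{2n})$
  in the case \<open>a = 1\<close>, where $(q;-q)_{2n} = (q;q^2)_n (-q^2;q^2)_n$ cancels one of the two products.\<close>

definition Xpow :: "nat \<Rightarrow> int fps" where "Xpow m = fps_X ^ (2 * m + 2)"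

lemma Xpow_Suc: "Xpow (Suc m) = Xpow m * fps_X\<^sup>2"
  by (simp add: Xpow_def power_add[symmetric])

lemma Xpow_nonneg [simp]: "fps_nonneg (Xpow m)"
  unfolding Xpow_def by (intro fps_nonneg_power fps_nonneg_X)

lemma nth_mult_Xpow_0: "n < 2 * m + 2 \<Longrightarrow> fps_nth (A * Xpow m) n = 0"
  unfolding Xpow_def by (rule fps_nth_mult_X_power_0)

lemma nth_mult_Xpow_power2_0: "n < 2 * m + 2 \<Longrightarrow> fps_nth (A * (Xpow m)\<^sup>2) n = 0"
  using nth_mult_Xpow_0[of n m "A * Xpow m"] by (simp add: power2_eq_square mult.assoc)

lemma geo_mult_Xpow: "fps_geo (2 * m + 3) * (1 - Xpow m * fps_X) = 1"
proof -
  have "Xpow m * fps_X = fps_X ^ (2 * m + 3)"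
    unfolding Xpow_def power_Suc2[symmetric] by (rule arg_cong[of _ _ "(^) fps_X"]) simp
  then show ?thesis using fps_geo_mult[of "2*m+3"] by simp
qed

lemma geo_mult_Xpow_power2: "fps_geo (4 * m + 4) * (1 - Xpow m * Xpow m) = 1"
proof -
  have "Xpow m * Xpow m = fps_X ^ (4 * m + 4)"
    unfolding Xpow_def power_add[symmetric] by (rule arg_cong[of _ _ "(^) fps_X"]) simp
  then show ?thesis using fps_geo_mult[of "4*m+4"] by simp
qed

lemma one_minus_Xpow: "1 - Xpow m = (1 - fps_X) * (\<Sum>i<2*m+2. fps_X ^ i)"
  unfolding Xpow_def by (rule one_diff_power_eq)

lemmas nonneg_intros = fps_nonneg_intros Xpow_nonneg

section \<open>Partial products and their telescoping identities\<close>

primrec Sfps :: "nat \<Rightarrow> nat \<Rightarrow> int fps" where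
  "Sfps a 0 = fps_geo 1"
| "Sfps a (Suc m) = Sfps a m * (1 + Xpow m) ^ a * fps_geo (2 * m + 3)"

text \<open>Common factor of two consecutive partial products: with x = \<open>Xpow m\<close>, S_m =
  B (1 - x q) and S_(m+1) = B (1 + x)^a. Both telescopings thereby become polynomial identities in x
  and q.\<close>

definition Bfps :: "nat \<Rightarrow> nat \<Rightarrow> int fps" where
  "Bfps a m = Sfps a m * fps_geo (2 * m + 3)"

definition Ksum :: "nat \<Rightarrow> nat \<Rightarrow> int fps" where
  "Ksum a T = (\<Sum>m<T. Bfps a m * Xpow m)"

definition K2sum :: "nat \<Rightarrow> nat \<Rightarrow> int fps" where
  "K2sum a T = (\<Sum>m<T. Bfps a m * (Xpow m)\<^sup>2)"

definition Hfps :: "nat \<Rightarrow> int fps" where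
  "Hfps m = Sfps 1 m * (1 - Xpow m) * fps_geo (4 * m + 4)"

definition Ufps :: "nat \<Rightarrow> nat \<Rightarrow> int fps" where
  "Ufps a m = (if a = 1 then Hfps m * Xpow m else Sfps a m * Xpow m)"

text \<open>The four sequences are read off the diagonal: whatever is added after truncation N
  carries a factor \<open>Xpow m\<close> with m \<ge> N and is divisible by q^(2N+2).\<close>

definition pcoeff :: "nat \<Rightarrow> nat \<Rightarrow> int" where "pcoeff a N = fps_nth (Sfps a N) N"
definition kcoeff :: "nat \<Rightarrow> nat \<Rightarrow> int" where "kcoeff a N = fps_nth (Ksum a N) N"
definition k2coeff :: "nat \<Rightarrow> nat \<Rightarrow> int" where "k2coeff a N = fps_nth (K2sum a N) N"
definition ucoeff :: "nat \<Rightarrow> nat \<Rightarrow> int" where "ucoeff a N = fps_nth (\<Sum>m<N. Ufps a m) N"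

text \<open>The only source of monotonicity is the initial factor 1/(1-q); the later factors merely
  have nonnegative coefficients.\<close>

lemma Sfps_incr: "fps_incr (Sfps a m)"
  by (induction m) (auto intro!: fps_incr_mult nonneg_intros fps_incr_geo_1 simp del: One_nat_def)

lemma Sfps_nonneg: "fps_nonneg (Sfps a m)" 
  using Sfps_incr fps_incr_nonneg by blast

lemma Bfps_incr: "fps_incr (Bfps a m)"
  unfolding Bfps_def by (intro fps_incr_mult Sfps_incr nonneg_intros)

lemma Bfps_nonneg: "fps_nonneg (Bfps a m)" 
  using Bfps_incr fps_incr_nonneg by blast

lemma Sfps_conv_Bfps: "Sfps a m = Bfps a m * (1 - Xpow m * fps_X)"
  using geo_mult_Xpow[of m] by (simp add: Bfps_def mult.assoc)

lemma Sfps_Suc_conv_Bfps: "Sfps a (Suc m) = Bfps a m * (1 + Xpow m) ^ a"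
  by (simp add: Bfps_def mult_ac)

lemma Sfps_diff:
  assumes "a \<in> {1, 2}"
  shows "Sfps a (Suc m) - Sfps a m = Bfps a m * Xpow m * (of_nat a + fps_X + of_nat (a - 1) * Xpow m)"
proof -
  show ?thesis
    using assms unfolding Sfps_Suc_conv_Bfps Sfps_conv_Bfps[of a m]
    by (auto simp: algebra_simps power2_eq_square)
qed

text \<open>Because x_(m+1) = q^2 x_m, the parts linear in x nearly cancel and leave -(1 - q^2) x;
  the rest is of order x^2, which is where \<open>K2sum\<close> enters.\<close>

lemma Sfps_Xpow_diff:
  assumes "a \<in> {1, 2}"
  shows "Sfps a (Suc m) * Xpow (Suc m) - Sfps a m * Xpow m =
    - (1 - fps_X\<^sup>2) * (Bfps a m * Xpow m)
    + Bfps a m * (Xpow m)\<^sup>2 * (of_nat a * fps_X\<^sup>2 + fps_X + of_nat (a - 1) * Xpow m * fps_X\<^sup>2)"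
proof -
  show ?thesis
    using assms unfolding Sfps_Suc_conv_Bfps Sfps_conv_Bfps[of a m] Xpow_Suc
    by (auto simp: algebra_simps power2_eq_square)
qed

lemma Sfps_nth:
  assumes a: "a \<in> {1, 2}"
  shows "N \<le> T \<Longrightarrow> fps_nth (Sfps a T) N = pcoeff a N"
proof (induction T rule: dec_induct)
  case (step m)
  have "fps_nth (Bfps a m * (of_nat a + fps_X + of_nat (a - 1) * Xpow m) * Xpow m) N = 0"
    using step by (intro nth_mult_Xpow_0) auto
  then have "fps_nth (Sfps a (Suc m) - Sfps a m) N = 0"
    by (subst Sfps_diff[OF a]) (simp add: mult_ac)
  then show ?case using step by simp
qed (simp add: pcoeff_def)

lemma Ksum_nth: "N \<le> T \<Longrightarrow> fps_nth (Ksum a T) N = kcoeff a N"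
  unfolding kcoeff_def Ksum_def by (rule sum_fps_nth_stable) (auto intro: nth_mult_Xpow_0 nth_mult_Xpow_power2_0)

lemma K2sum_nth: "N \<le> T \<Longrightarrow> fps_nth (K2sum a T) N = k2coeff a N"
  unfolding k2coeff_def K2sum_def
  by (rule sum_fps_nth_stable) (auto intro: nth_mult_Xpow_0 nth_mult_Xpow_power2_0)

lemma Ufps_sum_nth: "N \<le> T \<Longrightarrow> fps_nth (\<Sum>m<T. Ufps a m) N = ucoeff a N"
  unfolding ucoeff_def Ufps_def by (rule sum_fps_nth_stable) (auto intro: nth_mult_Xpow_0 nth_mult_Xpow_power2_0)

lemma Ksum_incr: "fps_incr (Ksum a T)"
  unfolding Ksum_def by (intro fps_incr_sum fps_incr_mult Bfps_incr nonneg_intros)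

lemma K2sum_incr: "fps_incr (K2sum a T)"
  unfolding K2sum_def by (intro fps_incr_sum fps_incr_mult Bfps_incr nonneg_intros)

lemma kcoeff_mono: "m \<le> n \<Longrightarrow> kcoeff a m \<le> kcoeff a n"
  by (metis Ksum_incr Ksum_nth fps_incr_le order_refl)

lemma kcoeff_nonneg: "0 \<le> kcoeff a n"
  using Ksum_incr fps_incr_nonneg unfolding kcoeff_def fps_nonneg_def by blast

lemma k2coeff_nonneg: "0 \<le> k2coeff a n"
  using K2sum_incr fps_incr_nonneg unfolding k2coeff_def fps_nonneg_def by blast

text \<open>Sum of \<open>Sfps_diff\<close> over m \<le> N, read at q^(N+1). The 1 is the
  coefficient of S_0 = 1/(1-q), and \<open>kcoeff a N\<close> comes from the shifted term q
  K.\<close>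

lemma pcoeff_conv_kcoeff:
  assumes a: "a \<in> {1, 2}"
  shows "pcoeff a (Suc N) - 1 = int a * kcoeff a (Suc N) + kcoeff a N + int (a - 1) * k2coeff a (Suc N)"
proof -
  let ?T = "Suc N"
  have "Sfps a ?T - Sfps a 0 = (\<Sum>m<?T. Sfps a (Suc m) - Sfps a m)"
    by (subst sum_lessThan_telescope) auto
  also have "\<dots> = of_nat a * Ksum a ?T + fps_X * Ksum a ?T + of_nat (a - 1) * K2sum a ?T"
    unfolding Sfps_diff[OF a] Ksum_def K2sum_def sum_distrib_left sum.distrib[symmetric]
    by (intro sum.cong) (auto simp: algebra_simps power2_eq_square)
  finally have "fps_nth (Sfps a ?T - Sfps a 0) ?T =
      fps_nth (of_nat a * Ksum a ?T + fps_X * Ksum a ?T + of_nat (a - 1) * K2sum a ?T) ?T"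
    by simp
  then show ?thesis
    by (simp add: Sfps_nth[OF a] Ksum_nth K2sum_nth fps_geo_def fps_of_nat[symmetric] del: Sfps.simps(2))
qed

lemma kcoeff_le_pcoeff:
  assumes a: "a \<in> {1, 2}"
  shows "kcoeff a (Suc N) \<le> pcoeff a (Suc N)"
  using pcoeff_conv_kcoeff[OF a, of N] kcoeff_nonneg[of a N] kcoeff_nonneg[of a "Suc N"] k2coeff_nonneg[of a "Suc N"] a
  by auto

section \<open>Monotone two-step increments of the coefficients of K\<close>

definition Dsum :: "nat \<Rightarrow> nat \<Rightarrow> int fps" where
  "Dsum a T = Sfps a 0 * Xpow 0 + K2sum a T * (of_nat a * fps_X\<^sup>2 + fps_X) +
     of_nat (a - 1) * fps_X\<^sup>2 * (\<Sum>m<T. Bfps a m * (Xpow m) ^ 3)"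

text \<open>The convexity that drives the comparison: \<open>Dsum a T\<close> is (1 - q^2) K up to a
  term beyond the truncation, and each of its pieces is a monotone series times a nonnegative
  one.\<close>

lemma Dsum_incr: "fps_incr (Dsum a T)"
  unfolding Dsum_def
  by (intro fps_incr_add fps_incr_mult fps_incr_mult' fps_incr_sum Sfps_incr Bfps_incr K2sum_incr nonneg_intros)

lemma Ksum_conv_Dsum:
  assumes a: "a \<in> {1, 2}"
  shows "(1 - fps_X\<^sup>2) * Ksum a T = Dsum a T - Sfps a T * Xpow T"
proof -
  have "Sfps a T * Xpow T - Sfps a 0 * Xpow 0 = (\<Sum>m<T. Sfps a (Suc m) * Xpow (Suc m) - Sfps a m * Xpow m)"
    by (subst sum_lessThan_telescope) auto
  also have "\<dots> = - (1 - fps_X\<^sup>2) * Ksum a T + K2sum a T * (of_nat a * fps_X\<^sup>2 + fps_X) +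
     of_nat (a - 1) * fps_X\<^sup>2 * (\<Sum>m<T. Bfps a m * (Xpow m) ^ 3)"
    unfolding Sfps_Xpow_diff[OF a] Ksum_def K2sum_def sum_distrib_left sum_distrib_right sum.distrib[symmetric]
    by (intro sum.cong) (auto simp: algebra_simps power2_eq_square power3_eq_cube)
  finally show ?thesis by (simp add: Dsum_def algebra_simps)
qed

definition kdiff :: "nat \<Rightarrow> nat \<Rightarrow> int" where "kdiff a N = kcoeff a (N + 2) - kcoeff a N"

lemma kdiff_conv_Dsum:
  assumes a: "a \<in> {1, 2}" and T: "N + 2 \<le> T"
  shows "kdiff a N = fps_nth (Dsum a T) (N + 2)"
proof -
  have "fps_nth (Dsum a T - Sfps a T * Xpow T) (N + 2) = fps_nth ((1 - fps_X\<^sup>2) * Ksum a T) (N + 2)"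
    by (simp only: Ksum_conv_Dsum[OF a])
  \<comment> \<open>The endpoint of the telescoping starts at q^(2T+2), out of reach of the
    coefficient N + 2 \<le> T.\<close>
  also have "fps_nth (Sfps a T * Xpow T) (N + 2) = 0" using T by (intro nth_mult_Xpow_0) auto
  then have "fps_nth (Dsum a T - Sfps a T * Xpow T) (N + 2) = fps_nth (Dsum a T) (N + 2)" by simp
  also have "fps_nth ((1 - fps_X\<^sup>2) * Ksum a T) (N + 2) = kdiff a N"
    using T by (simp add: kdiff_def algebra_simps fps_X_power_mult_right_nth fps_X_power_mult_nth Ksum_nth)
  finally show ?thesis by simp
qed

lemma kdiff_mono: "a \<in> {1, 2} \<Longrightarrow> m \<le> n \<Longrightarrow> kdiff a m \<le> kdiff a n"
  using kdiff_conv_Dsum[of a m "n + 2"] kdiff_conv_Dsum[of a n "n + 2"] fps_incr_le[OF Dsum_incr, of "m+2" "n+2" a "n+2"]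
  by simp

text \<open>\<open>Dsum\<close> contains the piece q K2 and its other pieces are nonnegative; the
  factor q accounts for N + 1 against N + 2.\<close>

lemma k2coeff_le_kdiff: assumes a: "a \<in> {1, 2}" shows "k2coeff a (Suc N) \<le> kdiff a N"
proof -
  let ?T = "N + 2"
  have "Dsum a ?T - fps_X * K2sum a ?T = Sfps a 0 * Xpow 0 + K2sum a ?T * (of_nat a * fps_X\<^sup>2) +
     of_nat (a - 1) * fps_X\<^sup>2 * (\<Sum>m<?T. Bfps a m * (Xpow m) ^ 3)"
    by (simp add: Dsum_def algebra_simps)
  also have "fps_nonneg \<dots>"
    by (intro nonneg_intros Sfps_nonneg fps_incr_nonneg[OF K2sum_incr] Bfps_nonneg)
  finally have "0 \<le> fps_nth (Dsum a ?T - fps_X * K2sum a ?T) ?T"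
    by (simp only: fps_nonneg_def)
  then show ?thesis by (simp add: kdiff_conv_Dsum[OF a, of N ?T] K2sum_nth)
qed

lemma kdiff_nonneg: "0 \<le> kdiff a N"
  unfolding kdiff_def using kcoeff_mono[of N "N+2" a] by simp

text \<open>M two-step increments beginning at N are each at least the first one, and their sum
  telescopes to at most the coefficient of K at N + 2M. The final + 1 provides a successor index for
  \<open>kcoeff_le_pcoeff\<close>.\<close>

lemma mult_kdiff_le:
  assumes a: "a \<in> {1, 2}"
  shows "int M * kdiff a N \<le> pcoeff a (N + 2 * M + 1)"
proof -
  have "int M * kdiff a N = (\<Sum>i<M. kdiff a N)" by simp
  also have "\<dots> \<le> (\<Sum>i<M. kdiff a (N + 2 * i))" by (intro sum_mono kdiff_mono[OF a]) simp
  also have "\<dots> = (\<Sum>i<M. kcoeff a (N + 2 * Suc i) - kcoeff a (N + 2 * i))" by (simp add: kdiff_def)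
  also have "\<dots> = kcoeff a (N + 2 * M) - kcoeff a N" by (subst sum_lessThan_telescope) simp
  also have "\<dots> \<le> kcoeff a (N + 2 * M + 1)" using kcoeff_nonneg[of a N] kcoeff_mono[of "N + 2 * M" "N + 2 * M + 1" a] by simp
  also have "\<dots> \<le> pcoeff a (N + 2 * M + 1)" using kcoeff_le_pcoeff[OF a] by simp
  finally show ?thesis .
qed

text \<open>In \<open>pcoeff_conv_kcoeff\<close>, replacing \<open>kcoeff a N\<close> by
  \<open>kcoeff a (Suc N)\<close> costs at most one \<open>kdiff a N\<close>, and the K2 term at
  most another; the 1 is left over from S_0.\<close>

lemma pcoeff_near_kcoeff:
  assumes a: "a \<in> {1, 2}"
  shows "\<bar>pcoeff a (Suc N) - int (a + 1) * kcoeff a (Suc N)\<bar> \<le> 1 + 2 * kdiff a N"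
proof -
  have "kcoeff a (Suc N) - kcoeff a N \<le> kdiff a N" unfolding kdiff_def using kcoeff_mono[of "Suc N" "N+2" a] by simp
  moreover have "kcoeff a N \<le> kcoeff a (Suc N)" by (rule kcoeff_mono) simp
  ultimately show ?thesis
    using pcoeff_conv_kcoeff[OF a, of N] k2coeff_le_kdiff[OF a, of N] k2coeff_nonneg[of a "Suc N"] kdiff_nonneg[of a N] a
    by (auto simp: algebra_simps)
qed

section \<open>Summands of the theorem compared with K\<close>

lemma Sfps_Xpow_sum_nth: "N < T \<Longrightarrow> fps_nth (\<Sum>m<T. Sfps a m * Xpow m) (Suc N) = kcoeff a (Suc N) - k2coeff a N"
proof -
  assume T: "N < T"
  have "(\<Sum>m<T. Sfps a m * Xpow m) = Ksum a T - fps_X * K2sum a T"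
    unfolding Sfps_conv_Bfps[of a] Ksum_def K2sum_def sum_distrib_left sum_subtractf[symmetric]
    by (intro sum.cong) (auto simp: algebra_simps power2_eq_square)
  then show ?thesis using T by (simp add: Ksum_nth K2sum_nth)
qed

text \<open>With $x = q^{2m+2}$, the factor $1-x$ of the numerator of
  $S_m/(1+x) = S_m (1-x)/(1-x^2)$ is absorbed by the factor $1/(1-q)$ of $S_m$.\<close>

lemma Hfps_nonneg: "fps_nonneg (Hfps m)"
proof -
  have "fps_nonneg ((1 - fps_X) * Sfps 1 m)" using Sfps_incr[of 1 m] by (simp only: fps_incr_def)
  moreover have "fps_nonneg ((\<Sum>i<2*m+2. fps_X ^ i) * fps_geo (4 * m + 4))"
    by (intro nonneg_intros)
  ultimately have "fps_nonneg (((1 - fps_X) * Sfps 1 m) * ((\<Sum>i<2*m+2. fps_X ^ i) * fps_geo (4 * m + 4)))"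
    by (rule fps_nonneg_mult)
  also have "((1 - fps_X) * Sfps 1 m) * ((\<Sum>i<2*m+2. fps_X ^ i) * fps_geo (4 * m + 4)) = Hfps m"
    unfolding Hfps_def one_minus_Xpow by (simp only: mult_ac)
  finally show ?thesis .
qed

lemma Hfps_conv_Sfps: "Hfps m * (1 + Xpow m) = Sfps 1 m"
proof -
  have "Hfps m * (1 + Xpow m) = Sfps 1 m * (fps_geo (4 * m + 4) * (1 - Xpow m * Xpow m))"
    by (simp add: Hfps_def algebra_simps)
  also have "fps_geo (4 * m + 4) * (1 - Xpow m * Xpow m) = 1" by (rule geo_mult_Xpow_power2)
  finally show ?thesis by simp
qed

lemma Ufps_nonneg: "fps_nonneg (Ufps a m)"
  unfolding Ufps_def by (auto intro!: nonneg_intros Hfps_nonneg Sfps_nonneg)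

text \<open>By \<open>Hfps_conv_Sfps\<close>, S x - H x = H x^2, so passing from the sum of S x to
  the series costs the sum of H x^2, which lies coefficientwise between 0 and K2; the other loss is
  K minus the sum of S x, that is q K2.\<close>

lemma ucoeff_1_near_kcoeff:
  "kcoeff 1 (Suc N) - k2coeff 1 N - k2coeff 1 (Suc N) \<le> ucoeff 1 (Suc N)" "ucoeff 1 (Suc N) \<le> kcoeff 1 (Suc N)"
proof -
  let ?T = "Suc N"
  have 1: "(\<Sum>m<?T. Sfps 1 m * Xpow m) - (\<Sum>m<?T. Ufps 1 m) = (\<Sum>m<?T. Hfps m * (Xpow m)\<^sup>2)"
    unfolding Ufps_def Hfps_conv_Sfps[symmetric] sum_subtractf[symmetric]
    by (intro sum.cong) (auto simp: algebra_simps power2_eq_square)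
  have "fps_nonneg (\<Sum>m<?T. Hfps m * (Xpow m)\<^sup>2)"
    by (intro nonneg_intros Hfps_nonneg)
  then have "0 \<le> fps_nth ((\<Sum>m<?T. Sfps 1 m * Xpow m) - (\<Sum>m<?T. Ufps 1 m)) ?T"
    unfolding 1 by (simp add: fps_nonneg_def)
  then show "ucoeff 1 (Suc N) \<le> kcoeff 1 (Suc N)"
    using k2coeff_nonneg[of 1 N] by (simp add: Sfps_Xpow_sum_nth Ufps_sum_nth del: One_nat_def sum.lessThan_Suc)
  \<comment> \<open>K2 minus the sum of H x^2 is nonnegative because B - H = B x q + (S - H) = B x q
    + H x.\<close>
  have "K2sum 1 ?T - (\<Sum>m<?T. Hfps m * (Xpow m)\<^sup>2) = (\<Sum>m<?T. Bfps 1 m * Xpow m * (Xpow m)\<^sup>2 * fps_X +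
      (Bfps 1 m * (1 - Xpow m * fps_X) - Hfps m) * (Xpow m)\<^sup>2)"
    unfolding K2sum_def sum_subtractf[symmetric] by (intro sum.cong) (auto simp: algebra_simps)
  also have "\<dots> = (\<Sum>m<?T. Bfps 1 m * Xpow m * (Xpow m)\<^sup>2 * fps_X + Hfps m * Xpow m * (Xpow m)\<^sup>2)"
    unfolding Sfps_conv_Bfps[symmetric] Hfps_conv_Sfps[symmetric] by (simp add: algebra_simps)
  also have "fps_nonneg \<dots>"
    by (intro nonneg_intros Hfps_nonneg Bfps_nonneg)
  finally have "0 \<le> fps_nth (K2sum 1 ?T - ((\<Sum>m<?T. Sfps 1 m * Xpow m) - (\<Sum>m<?T. Ufps 1 m))) ?T"
    unfolding 1 by (simp add: fps_nonneg_def)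
  then show "kcoeff 1 (Suc N) - k2coeff 1 N - k2coeff 1 (Suc N) \<le> ucoeff 1 (Suc N)"
    by (simp add: Sfps_Xpow_sum_nth Ufps_sum_nth K2sum_nth del: One_nat_def sum.lessThan_Suc)
qed

text \<open>There are at most two losses of size K2, at N + 1 and N + 2, and monotonicity puts both
  below \<open>kdiff a (Suc N)\<close>. The index starts at 2 since \<open>k2coeff_le_kdiff\<close>
  speaks of successors.\<close>

lemma ucoeff_near_kcoeff:
  assumes a: "a \<in> {1, 2}"
  shows "\<bar>ucoeff a (Suc (Suc N)) - kcoeff a (Suc (Suc N))\<bar> \<le> 2 * kdiff a (Suc N)"
proof -
  have d: "kdiff a N \<le> kdiff a (Suc N)" by (rule kdiff_mono[OF a]) simp
  consider "a = 1" | "a = 2" using a by auto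
  then show ?thesis
  proof cases
    case 1
    then show ?thesis
      using ucoeff_1_near_kcoeff[of "Suc N"] k2coeff_le_kdiff[OF a, of N] k2coeff_le_kdiff[OF a, of "Suc N"] d unfolding 1 by linarith
  next
    case 2
    have "ucoeff a (Suc (Suc N)) = kcoeff a (Suc (Suc N)) - k2coeff a (Suc N)"
      using Sfps_Xpow_sum_nth[of "Suc N" "Suc (Suc N)" a] Ufps_sum_nth[of "Suc (Suc N)" "Suc (Suc N)" a] 2
      by (simp add: Ufps_def del: sum.lessThan_Suc)
    then show ?thesis
      using k2coeff_le_kdiff[OF a, of N] k2coeff_nonneg[of a "Suc N"] d by linarith
  qed
qed

section \<open>Coefficient ratios in the limit\<close>

lemma ratio_shift_tendsto_1:
  fixes f :: "nat \<Rightarrow> real"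
  assumes "(\<lambda>n. f (Suc n) / f n) \<longlonglongrightarrow> 1" "\<forall>\<^sub>F n in at_top. f n > 0"
  shows "(\<lambda>n. f (n + j) / f n) \<longlonglongrightarrow> 1"
proof (induction j)
  case 0
  then show ?case using assms(2) by (intro tendsto_eventually) (auto elim: eventually_mono)
next
  case (Suc j)
  have "(\<lambda>n. f (Suc (n + j)) / f (n + j) * (f (n + j) / f n)) \<longlonglongrightarrow> 1 * 1"
    using LIMSEQ_ignore_initial_segment[OF assms(1), of j] Suc by (intro tendsto_mult) auto
  moreover have "\<forall>\<^sub>F n in at_top. f (n + j) > 0"
    using assms(2) by (auto simp: eventually_at_top_linorder) (meson trans_le_add1)
  then have "\<forall>\<^sub>F n in at_top. f (Suc (n + j)) / f (n + j) * (f (n + j) / f n) = f (n + Suc j) / f n"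
    by eventually_elim auto
  from tendsto_cong[OF this] calculation show ?case by simp
qed

lemma kdiff_over_pcoeff_tendsto_0:
  assumes a: "a \<in> {1, 2}"
  assumes top: "filterlim (\<lambda>n. real_of_int (pcoeff a n)) at_top at_top"
  assumes ratio: "(\<lambda>n. real_of_int (pcoeff a (Suc n)) / real_of_int (pcoeff a n)) \<longlonglongrightarrow> 1"
  shows "(\<lambda>n. real_of_int (kdiff a n) / real_of_int (pcoeff a n)) \<longlonglongrightarrow> 0"
proof (rule LIMSEQ_I)
  fix r :: real assume r: "r > 0"
  \<comment> \<open>M increments fit below p(n + 2M + 1), which for fixed M is eventually less than
    2 p(n); hence kdiff/p is below 2/M < r.\<close>
  obtain M :: nat where M: "2 / r < real M" using reals_Archimedean2 by blast
  then have M0: "real M > 0" using r by (smt (verit) divide_pos_pos)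
  have pos: "\<forall>\<^sub>F n in at_top. real_of_int (pcoeff a n) > 0"
    using top unfolding filterlim_at_top_dense by blast
  have "(\<lambda>n. real_of_int (pcoeff a (n + (2 * M + 1))) / real_of_int (pcoeff a n)) \<longlonglongrightarrow> 1"
    by (rule ratio_shift_tendsto_1[OF ratio pos])
  then have "\<forall>\<^sub>F n in at_top. real_of_int (pcoeff a (n + (2 * M + 1))) / real_of_int (pcoeff a n) < 2"
    by (rule order_tendstoD) simp
  with pos have "\<forall>\<^sub>F n in at_top. norm (real_of_int (kdiff a n) / real_of_int (pcoeff a n) - 0) < r"
  proof eventually_elim
    case (elim n)
    have "real M * real_of_int (kdiff a n) = real_of_int (int M * kdiff a n)" by simp
    also have "\<dots> \<le> real_of_int (pcoeff a (n + 2 * M + 1))" 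
      unfolding of_int_le_iff by (rule mult_kdiff_le[OF a])
    also have "\<dots> < 2 * real_of_int (pcoeff a n)" using elim by (simp add: field_simps)
    also have "\<dots> < real M * r * real_of_int (pcoeff a n)" 
      using M r elim by (intro mult_strict_right_mono) (auto simp: field_simps)
    finally have "real_of_int (kdiff a n) < r * real_of_int (pcoeff a n)"
      using M0 by (simp add: mult.assoc)
    then show ?case using elim kdiff_nonneg[of a n] by (simp add: field_simps)
  qed
  then show "\<exists>no. \<forall>n\<ge>no. norm (real_of_int (kdiff a n) / real_of_int (pcoeff a n) - 0) < r"
    by (simp add: eventually_at_top_linorder)
qed

text \<open>The total error is at most 4 \<open>kdiff\<close> + 1: 2 \<open>kdiff\<close> from the
  series against K and 1 + 2 \<open>kdiff\<close> from P/(a+1) against K, where the division by a +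
  1 is given away.\<close>

lemma ucoeff_over_pcoeff_tendsto:
  assumes a: "a \<in> {1, 2}"
  assumes top: "filterlim (\<lambda>n. real_of_int (pcoeff a n)) at_top at_top"
  assumes ratio: "(\<lambda>n. real_of_int (pcoeff a (Suc n)) / real_of_int (pcoeff a n)) \<longlonglongrightarrow> 1"
  shows "(\<lambda>n. real_of_int (ucoeff a n) / real_of_int (pcoeff a n)) \<longlonglongrightarrow> 1 / real (a + 1)"
proof -
  have pos: "\<forall>\<^sub>F n in at_top. real_of_int (pcoeff a n) > 0"
    using top unfolding filterlim_at_top_dense by blast
  have "(\<lambda>n. real_of_int (ucoeff a n) / real_of_int (pcoeff a n) - 1 / real (a + 1)) \<longlonglongrightarrow> 0"
  proof (rule Lim_null_comparison)
    show "\<forall>\<^sub>F n in at_top. norm (real_of_int (ucoeff a n) / real_of_int (pcoeff a n) - 1 / real (a + 1))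
        \<le> 4 * (real_of_int (kdiff a n) / real_of_int (pcoeff a n)) + 1 / real_of_int (pcoeff a n)"
      using pos eventually_ge_at_top[of 2]
    proof eventually_elim
      case (elim n)
      then obtain N where N: "n = Suc (Suc N)" by (metis Suc_le_D numeral_2_eq_2 Suc_le_mono)
      have dn: "real_of_int (kdiff a (Suc N)) \<le> real_of_int (kdiff a n)" using kdiff_mono[OF a, of "Suc N" n] N by simp
      have 1: "\<bar>real_of_int (ucoeff a n) - real_of_int (kcoeff a n)\<bar> \<le> 2 * real_of_int (kdiff a (Suc N))"
        using ucoeff_near_kcoeff[OF a, of N] unfolding N by linarith
      have "real_of_int \<bar>pcoeff a n - int (a + 1) * kcoeff a n\<bar> \<le> real_of_int (1 + 2 * kdiff a (Suc N))"
        using pcoeff_near_kcoeff[OF a, of "Suc N"] unfolding N of_int_le_iff .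
      then have "\<bar>real_of_int (pcoeff a n) - real (a + 1) * real_of_int (kcoeff a n)\<bar> \<le> 1 + 2 * real_of_int (kdiff a (Suc N))"
        by simp
      then have "\<bar>real_of_int (pcoeff a n) / real (a + 1) - real_of_int (kcoeff a n)\<bar>
          \<le> (1 + 2 * real_of_int (kdiff a (Suc N))) / real (a + 1)"
        by (smt (verit) abs_divide diff_divide_distrib divide_right_mono nonzero_mult_div_cancel_left of_nat_0_le_iff of_nat_1 of_nat_add)
      also have "\<dots> \<le> 1 + 2 * real_of_int (kdiff a (Suc N))"
        using kdiff_nonneg[of a "Suc N"] by (simp add: field_simps)
      finally have 2: "\<bar>real_of_int (ucoeff a n) - real_of_int (pcoeff a n) / real (a + 1)\<bar> \<le> 4 * real_of_int (kdiff a n) + 1"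
        using 1 dn by linarith
      have "real_of_int (ucoeff a n) / real_of_int (pcoeff a n) - 1 / real (a + 1) =
          (real_of_int (ucoeff a n) - real_of_int (pcoeff a n) / real (a + 1)) / real_of_int (pcoeff a n)"
        using elim by (simp add: field_simps)
      also have "norm \<dots> \<le> (4 * real_of_int (kdiff a n) + 1) / real_of_int (pcoeff a n)"
        using elim 2 by (simp add: divide_right_mono)
      finally show ?case by (simp add: add_divide_distrib)
    qed
    show "(\<lambda>n. 4 * (real_of_int (kdiff a n) / real_of_int (pcoeff a n)) + 1 / real_of_int (pcoeff a n)) \<longlonglongrightarrow> 0"
      using tendsto_add[OF tendsto_mult[OF tendsto_const[of "4::real"] kdiff_over_pcoeff_tendsto_0[OF a top ratio]]
          tendsto_inverse_0_at_top[OF top]]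
      by (simp add: inverse_eq_divide)
  qed
  then show ?thesis by (simp add: LIM_zero_iff)
qed

section \<open>The logarithm of the infinite product\<close>

text \<open>At n = 0 the division by zero yields 0, so the series effectively starts at n =
  1.\<close>

definition alt_coeff :: "nat \<Rightarrow> complex" where
  "alt_coeff n = (-1) ^ n / (of_nat n)\<^sup>2"

text \<open>This is Li_2(-z) on the closed unit disc; composed with exp(-w) it is an antiderivative
  of log(1 + e^(-w)).\<close>

definition dilog :: "complex \<Rightarrow> complex" where
  "dilog z = (\<Sum>n. alt_coeff n * z ^ n)"

text \<open>Write (-1)^n = 2 [n even] - 1; the even part of the sum of 1/n^2 is a quarter of the
  whole.\<close>

lemma alternating_inverse_squares_sums: "(\<lambda>n. (-1) ^ n / (real n)\<^sup>2) sums (- (pi\<^sup>2 / 12))"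
proof -
  define h :: "nat \<Rightarrow> real" where "h n = 1 / (real n)\<^sup>2" for n
  have "(\<lambda>n. h (Suc n)) sums (pi\<^sup>2 / 6)"
    using inverse_squares_sums by (simp add: h_def add.commute)
  then have h: "h sums (pi\<^sup>2 / 6)" by (subst (asm) sums_Suc_iff) (simp add: h_def)
  have "(\<lambda>n. if even n then h n else 0) sums (pi\<^sup>2 / 6 / 4)"
  proof (subst sums_mono_reindex[of "\<lambda>n. 2 * n", symmetric])
    show "(\<lambda>n. if even (2 * n) then h (2 * n) else 0) sums (pi\<^sup>2 / 6 / 4)"
      using sums_divide[OF h, of 4] by (simp add: h_def power_mult_distrib mult.commute)
  qed (auto simp: strict_mono_def elim!: evenE)
  from sums_diff[OF sums_mult[OF this, of 2] h]
  have "(\<lambda>n. 2 * (if even n then h n else 0) - h n) sums (- (pi\<^sup>2 / 12))" by simp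
  also have "(\<lambda>n. 2 * (if even n then h n else 0) - h n) = (\<lambda>n. (-1) ^ n / (real n)\<^sup>2)"
    by (auto simp: h_def fun_eq_iff)
  finally show ?thesis .
qed

lemma norm_alt_coeff: "norm (alt_coeff n) = 1 / (real n)\<^sup>2"
  by (simp add: alt_coeff_def norm_divide norm_power)

lemma summable_alt_coeff: "summable (\<lambda>n. norm (alt_coeff n))"
proof -
  have "summable (\<lambda>n. norm (alt_coeff (Suc n)))"
    using inverse_squares_sums by (simp add: norm_alt_coeff sums_iff add.commute)
  then show ?thesis by (subst (asm) summable_Suc_iff)
qed

text \<open>The closed disc matters: w = 0 corresponds to the boundary point 1, where the trapezoid
  rule begins.\<close>

lemma continuous_on_dilog: "continuous_on (cball 0 1) dilog"
proof -
  have "uniform_limit (cball 0 1) (\<lambda>n z. \<Sum>i<n. alt_coeff i * z ^ i) (\<lambda>z. \<Sum>i. alt_coeff i * z ^ i) sequentially"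
    by (rule Weierstrass_m_test[OF _ summable_alt_coeff])
       (auto simp: norm_mult norm_power intro!: mult_left_le power_le_one)
  then show ?thesis unfolding dilog_def
    by (rule uniform_limit_theorem[rotated]) (auto intro!: always_eventually continuous_intros)
qed

lemma dilog_1: "dilog 1 = - of_real (pi\<^sup>2 / 12)"
proof -
  have "(\<lambda>n. complex_of_real ((-1) ^ n / (real n)\<^sup>2)) sums of_real (- (pi\<^sup>2 / 12))"
    using alternating_inverse_squares_sums by (rule sums_of_real)
  then have "alt_coeff sums (- of_real (pi\<^sup>2 / 12))" by (simp add: alt_coeff_def[abs_def])
  then show ?thesis by (simp add: dilog_def sums_iff)
qed

lemma dilog_0: "dilog 0 = 0"
  unfolding dilog_def powser_zero by (simp add: alt_coeff_def)

lemma diffs_alt_coeff: "diffs alt_coeff n = (-1) ^ Suc n / of_nat (Suc n)"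
  by (simp add: diffs_def alt_coeff_def power2_eq_square del: of_nat_Suc)

lemma dilog_has_field_derivative:
  assumes "norm z < 1"
  shows "(dilog has_field_derivative (\<Sum>n. (-1) ^ Suc n / of_nat (Suc n) * z ^ n)) (at z)"
proof -
  have "summable (\<lambda>n. alt_coeff n * 1 ^ n)"
    using summable_alt_coeff by (simp add: summable_norm_cancel)
  from termdiffs_strong[OF this] assms
  show ?thesis unfolding dilog_def[abs_def] by (simp add: diffs_alt_coeff del: of_nat_Suc power_Suc)
qed

text \<open>The inner derivative -e^(-w) restores the power of z by which the derivative of
  \<open>dilog\<close> falls short of the logarithm series.\<close>

lemma dilog_exp_has_field_derivative:
  assumes "Re w > 0"
  shows "((\<lambda>w. dilog (exp (- w))) has_field_derivative Ln (1 + exp (- w))) (at w)"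
proof -
  define z where "z = exp (- w)"
  have z: "norm z < 1" using assms by (simp add: z_def)
  have "(\<lambda>n. (-1) ^ Suc n / of_nat n * z ^ n) sums Ln (1 + z)" by (rule Ln_series[OF z])
  then have "(\<lambda>n. (-1) ^ Suc (Suc n) / of_nat (Suc n) * z ^ Suc n) sums Ln (1 + z)"
    by (subst sums_Suc_iff) simp
  then have 1: "(\<lambda>n. (- z) * ((-1) ^ Suc n / of_nat (Suc n) * z ^ n)) sums Ln (1 + z)"
    by (simp add: mult_ac del: of_nat_Suc)
  then have "summable (\<lambda>n. (- z) * ((-1) ^ Suc n / of_nat (Suc n) * z ^ n))" by (rule sums_summable)
  then have "summable (\<lambda>n. (-1) ^ Suc n / of_nat (Suc n) * z ^ n)"
    by (subst (asm) summable_cmult_iff) (auto simp: z_def)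
  then have 2: "Ln (1 + z) = (- z) * (\<Sum>n. (-1) ^ Suc n / of_nat (Suc n) * z ^ n)"
    using 1 by (subst suminf_mult[symmetric]) (auto simp only: sums_iff)
  have "((\<lambda>w. exp (- w)) has_field_derivative - z) (at w)"
    unfolding z_def by (auto intro!: derivative_eq_intros)
  from DERIV_chain2[OF dilog_has_field_derivative[of "exp (- w)"] this] z
  have "((\<lambda>w. dilog (exp (- w))) has_field_derivative
      (\<Sum>n. (-1) ^ Suc n / of_nat (Suc n) * z ^ n) * (- z)) (at w)"
    by (simp only: z_def)
  also have "(\<Sum>n. (-1) ^ Suc n / of_nat (Suc n) * z ^ n) * (- z) = Ln (1 + z)"
    by (simp only: 2 mult.commute)
  finally show ?thesis by (simp only: z_def)
qed

section \<open>Trapezoid rule for log(1 + e^(-w)) in a sector\<close>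

definition sector :: "complex set" where
  "sector = {w. 0 < Re w \<and> \<bar>Im w\<bar> \<le> Re w}"

text \<open>The zeros of 1 + e^(-w) lie on the imaginary axis at distance at least pi from 0, and
  the sector stays away from them: for |Im w| \<le> pi/2 the real part of e^(-w) is nonnegative,
  otherwise Re w \<ge> 1 makes |e^(-w)| at most 1/2.\<close>

lemma norm_one_plus_exp_ge:
  assumes "w \<in> sector"
  shows "norm (1 + exp (- w)) \<ge> 1 / 2"
proof (cases "\<bar>Im w\<bar> \<le> pi / 2")
  case True
  then have "cos (Im w) \<ge> 0" by (intro cos_ge_zero) auto
  then have "1 \<le> Re (1 + exp (- w))" by (simp add: Re_exp)
  also have "\<dots> \<le> norm (1 + exp (- w))" by (rule complex_Re_le_cmod)
  finally show ?thesis by simp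
next
  case False
  then have "Re w \<ge> 1" using assms pi_gt3 by (auto simp: sector_def)
  have "exp (- Re w) \<le> 1 / (1 + Re w)"
    using exp_ge_add_one_self[of "Re w"] \<open>Re w \<ge> 1\<close> by (simp add: exp_minus field_simps)
  also have "\<dots> \<le> 1 / 2" using \<open>Re w \<ge> 1\<close> by (simp add: field_simps)
  finally have "exp (- Re w) \<le> 1 / 2" .
  moreover have "norm (1 + exp (- w)) \<ge> norm (1::complex) - norm (exp (- w))"
    by (rule norm_diff_ineq)
  ultimately show ?thesis by simp
qed

lemma one_plus_exp_not_nonpos:
  assumes "Re w > 0"
  shows "1 + exp (- w) \<notin> \<real>\<^sub>\<le>\<^sub>0"
proof -
  have "\<bar>Re (exp (- w))\<bar> \<le> norm (exp (- w))" by (rule abs_Re_le_cmod)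
  also have "\<dots> < 1" using assms by simp
  finally show ?thesis by (auto simp: complex_nonpos_Reals_iff)
qed

lemma one_plus_exp_neq_0: "Re w > 0 \<Longrightarrow> 1 + exp (- w) \<noteq> (0::complex)"
  using one_plus_exp_not_nonpos by fastforce

lemma Ln_one_plus_exp_has_field_derivative:
  assumes "Re w > 0"
  shows "((\<lambda>w. Ln (1 + exp (- w))) has_field_derivative - exp (- w) / (1 + exp (- w))) (at w)"
  using one_plus_exp_not_nonpos[OF assms] one_plus_exp_neq_0[OF assms]
  by (auto intro!: derivative_eq_intros simp: field_simps)

lemma exp_over_has_field_derivative:
  assumes "Re w > 0"
  shows "((\<lambda>w. - exp (- w) / (1 + exp (- w))) has_field_derivative exp (- w) / (1 + exp (- w))\<^sup>2) (at w)"
  using one_plus_exp_neq_0[OF assms]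
  by (auto intro!: derivative_eq_intros simp: field_simps power2_eq_square)

lemma convex_sector: "convex sector"
proof -
  have eq: "sector = {w. Re w > 0} \<inter> {w. inner (Complex 1 (-1)) w \<ge> 0} \<inter> {w. inner (Complex 1 1) w \<ge> 0}"
    by (auto simp: sector_def inner_complex_def)
  show ?thesis unfolding eq by (intro convex_Int convex_halfspace_Re_gt convex_halfspace_ge)
qed

lemma sector_add: "w \<in> sector \<Longrightarrow> z \<in> sector \<Longrightarrow> w + z \<in> sector"
  by (auto simp: sector_def)

lemma sector_mult: "z \<in> sector \<Longrightarrow> c > 0 \<Longrightarrow> of_real c * z \<in> sector"
  by (auto simp: sector_def abs_mult)

text \<open>Taylor expansion at w, of second order for the antiderivative and of first order for its
  derivative: the quadratic terms cancel in the trapezoid combination and a cubic error remains. The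
  4 is 1/(1/2)^2, from the lower bound on |1 + e^(-w)|.\<close>

lemma trapezoid_bound:
  assumes w: "w \<in> sector" and z: "z \<in> sector"
  shows "norm (dilog (exp (- (w + z))) - dilog (exp (- w)) -
           z / 2 * (Ln (1 + exp (- w)) + Ln (1 + exp (- (w + z))))) \<le> 4 * norm z ^ 3 * exp (- Re w)"
proof -
  define C where "C = 4 * exp (- Re w)"
  \<comment> \<open>A convex set holding both w and w + z, on which e^(-Re u) \<le> e^(-Re
    w).\<close>
  define V where "V = sector \<inter> {u. Re u \<ge> Re w}"
  define f where "f i = (\<lambda>w. if i = 0 then dilog (exp (- w)) else if i = 1 then Ln (1 + exp (- w))
     else if i = 2 then - exp (- w) / (1 + exp (- w)) else exp (- w) / (1 + exp (- w))\<^sup>2)"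
    for i :: nat
  have V: "convex V" unfolding V_def by (intro convex_Int convex_sector convex_halfspace_Re_ge)
  have wV: "w \<in> V" "w + z \<in> V" using assms sector_add[OF assms] by (auto simp: V_def sector_def)
  have der: "(f i has_field_derivative f (Suc i) x) (at x within V)" if "x \<in> V" "i \<le> 2" for i x
  proof -
    have "Re x > 0" using that by (auto simp: V_def sector_def)
    moreover have "i = 0 \<or> i = 1 \<or> i = 2" using that by auto
    ultimately show ?thesis
      using dilog_exp_has_field_derivative[of x] Ln_one_plus_exp_has_field_derivative[of x]
        exp_over_has_field_derivative[of x]
      by (auto simp: f_def intro: has_field_derivative_at_within)
  qed
  have bound: "norm (f 3 x) \<le> C" if "x \<in> V" for x
  proof -
    have "(1 / 2)\<^sup>2 \<le> (norm (1 + exp (- x)))\<^sup>2"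
      using norm_one_plus_exp_ge[of x] that by (intro power_mono) (auto simp: V_def)
    then have "norm (exp (- x)) / norm ((1 + exp (- x))\<^sup>2) \<le> exp (- Re w) / (1 / 2)\<^sup>2"
      using that by (intro frac_le) (auto simp: V_def norm_power)
    then show ?thesis by (simp add: f_def C_def norm_divide power2_eq_square)
  qed
  have "norm (f 0 (w + z) - (\<Sum>i\<le>2. f i w * (w + z - w) ^ i / fact i)) \<le> C * norm (w + z - w) ^ Suc 2 / fact 2"
    using der bound wV by (intro complex_Taylor[OF V]) (auto simp: eval_nat_numeral)
  then have 1: "norm (f 0 (w + z) - f 0 w - f 1 w * z - f 2 w * z\<^sup>2 / 2) \<le> C * norm z ^ 3 / 2"
    by (simp add: eval_nat_numeral algebra_simps)
  have "norm (f (Suc 0) (w + z) - (\<Sum>i\<le>1. f (Suc i) w * (w + z - w) ^ i / fact i)) \<le> C * norm (w + z - w) ^ Suc 1 / fact 1"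
    using der bound wV by (intro complex_Taylor[OF V, of 1 "\<lambda>i. f (Suc i)"]) (auto simp: eval_nat_numeral)
  then have "norm (f 1 (w + z) - f 1 w - f 2 w * z) \<le> C * norm z ^ 2"
    by (simp add: eval_nat_numeral algebra_simps)
  then have "norm z / 2 * norm (f 1 (w + z) - f 1 w - f 2 w * z) \<le> norm z / 2 * (C * norm z ^ 2)"
    by (intro mult_left_mono) auto
  then have 2: "norm (z / 2 * (f 1 (w + z) - f 1 w - f 2 w * z)) \<le> C * norm z ^ 3 / 2"
    by (simp add: norm_mult norm_divide power2_eq_square power3_eq_cube mult_ac)
  have "f 0 (w + z) - f 0 w - z / 2 * (f 1 w + f 1 (w + z)) =
    (f 0 (w + z) - f 0 w - f 1 w * z - f 2 w * z\<^sup>2 / 2) - z / 2 * (f 1 (w + z) - f 1 w - f 2 w * z)"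
    by (simp add: field_simps power2_eq_square)
  also have "norm \<dots> \<le> C * norm z ^ 3 / 2 + C * norm z ^ 3 / 2"
    by (rule order.trans[OF norm_triangle_ineq4 add_mono[OF 1 2]])
  finally show ?thesis by (simp add: f_def C_def mult_ac)
qed

text \<open>The first segment starts at 0, outside the sector; its bound is the limit of
  \<open>trapezoid_bound\<close> along w = 1/(n+1).\<close>

lemma trapezoid_bound_0:
  assumes z: "z \<in> sector"
  shows "norm (dilog (exp (- z)) - dilog 1 - z / 2 * (Ln 2 + Ln (1 + exp (- z)))) \<le> 4 * norm z ^ 3"
proof -
  define F where "F w = norm (dilog (exp (- (w + z))) - dilog (exp (- w)) -
           z / 2 * (Ln (1 + exp (- w)) + Ln (1 + exp (- (w + z)))))" for w
  define r where "r n = complex_of_real (1 / real (Suc n))" for n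
  have r: "r \<longlonglongrightarrow> 0" 
    unfolding r_def using tendsto_of_real[OF LIMSEQ_Suc[OF lim_1_over_n], where ?'a = complex] by simp
  have rz: "Re (r n) > 0" "r n \<in> sector" for n by (auto simp: r_def sector_def)
  have z0: "Re z > 0" using z by (auto simp: sector_def)
  have D: "(\<lambda>n. dilog (exp (- (r n + c)))) \<longlonglongrightarrow> dilog (exp (- (0 + c)))" if "Re c \<ge> 0" for c
  proof (rule continuous_on_tendsto_compose[OF continuous_on_dilog])
    show "(\<lambda>n. exp (- (r n + c))) \<longlonglongrightarrow> exp (- (0 + c))" by (intro tendsto_intros r)
    show "\<forall>\<^sub>F n in sequentially. exp (- (r n + c)) \<in> cball 0 1"
    proof (intro always_eventually allI)
      fix n show "exp (- (r n + c)) \<in> cball 0 1" using that rz(1)[of n] by simp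
    qed
  qed (use that in auto)
  have "(\<lambda>n. F (r n)) \<longlonglongrightarrow> norm (dilog (exp (- (0 + z))) - dilog (exp (- (0 + 0))) - z / 2 * (Ln (1 + exp (- 0)) + Ln (1 + exp (- (0 + z)))))"
    unfolding F_def using D[of z] D[of 0] z0 one_plus_exp_not_nonpos[of z]
    by (intro tendsto_intros r) (auto simp: complex_nonpos_Reals_iff)
  moreover have "(\<lambda>n. 4 * norm z ^ 3 * exp (- Re (r n))) \<longlonglongrightarrow> 4 * norm z ^ 3 * exp (- Re 0)"
    by (intro tendsto_intros r)
  ultimately have "norm (dilog (exp (- (0 + z))) - dilog (exp (- (0 + 0))) - z / 2 * (Ln (1 + exp (- 0)) + Ln (1 + exp (- (0 + z)))))
      \<le> 4 * norm z ^ 3 * exp (- Re 0)"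
    by (rule LIMSEQ_le) (use trapezoid_bound[OF rz(2) z] in \<open>auto simp: F_def\<close>)
  then show ?thesis by simp
qed

section \<open>Logarithm of the product of 1 + e^(-jz) as z tends to 0\<close>

definition logQ :: "complex \<Rightarrow> complex" where
  "logQ z = (\<Sum>j. Ln (1 + exp (- (of_nat (Suc j) * z))))"

lemma exp_mult_tendsto_0:
  fixes z :: complex
  assumes "Re z > 0"
  shows "(\<lambda>n. exp (- (of_nat n * z))) \<longlonglongrightarrow> 0"
proof -
  have "(\<lambda>n. exp (- z) ^ n) \<longlonglongrightarrow> 0" using assms by (intro LIMSEQ_power_zero) auto
  then show ?thesis by (simp add: exp_of_nat_mult[symmetric])
qed

lemma summable_logQ:
  assumes "Re z > 0"
  shows "summable (\<lambda>j. Ln (1 + exp (- (of_nat (Suc j) * z))))"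
proof (rule summable_comparison_test_ev)
  have "(\<lambda>j. norm (exp (- (of_nat (Suc j) * z)))) \<longlonglongrightarrow> 0"
    by (intro tendsto_norm_zero LIMSEQ_Suc exp_mult_tendsto_0 assms)
  then have "\<forall>\<^sub>F j in sequentially. norm (exp (- (of_nat (Suc j) * z))) < 1 / 2"
    by (rule order_tendstoD) simp
  then show "\<forall>\<^sub>F j in sequentially. norm (Ln (1 + exp (- (of_nat (Suc j) * z)))) \<le> 2 * exp (- Re z) ^ Suc j"
  proof eventually_elim
    case (elim j)
    have "norm (exp (- (of_nat (Suc j) * z))) = exp (- Re z) ^ Suc j"
      by (simp add: exp_of_nat_mult[symmetric] del: of_nat_Suc power_Suc)
    then show ?case using norm_Ln_le[OF elim] by simp
  qed
  show "summable (\<lambda>j. 2 * exp (- Re z) ^ Suc j)"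
    using assms by (intro summable_mult) (simp only: summable_Suc_iff, intro summable_geometric, simp)
qed

text \<open>\<open>logQ\<close> is a sum of principal logarithms, which need not be the principal
  logarithm of the product; only its exponential is identified with the product.\<close>

lemma prod_tendsto_exp_logQ:
  assumes "Re z > 0"
  shows "(\<lambda>n. \<Prod>j<n. 1 + exp (- z) ^ Suc j) \<longlonglongrightarrow> exp (logQ z)"
proof -
  have "(\<lambda>n. exp (\<Sum>j<n. Ln (1 + exp (- (of_nat (Suc j) * z))))) \<longlonglongrightarrow> exp (logQ z)"
    unfolding logQ_def by (intro tendsto_exp summable_LIMSEQ summable_logQ assms)
  also have "(\<lambda>n. exp (\<Sum>j<n. Ln (1 + exp (- (of_nat (Suc j) * z))))) = (\<lambda>n. \<Prod>j<n. 1 + exp (- z) ^ Suc j)"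
  proof
    fix n
    have "exp (Ln (1 + exp (- (of_nat (Suc j) * z)))) = 1 + exp (- z) ^ Suc j" for j
    proof -
      have "Re (of_nat (Suc j) * z) > 0" using assms by simp
      from one_plus_exp_neq_0[OF this] show ?thesis
        by (simp add: exp_of_nat_mult[symmetric] del: of_nat_Suc power_Suc)
    qed
    then show "exp (\<Sum>j<n. Ln (1 + exp (- (of_nat (Suc j) * z)))) = (\<Prod>j<n. 1 + exp (- z) ^ Suc j)"
      by (simp add: exp_sum)
  qed
  finally show ?thesis .
qed

text \<open>On the segments from jz to (j+1)z the antiderivative telescopes from dilog 1 = -pi^2/12
  to dilog 0 = 0, and the half weight at the node 0 gives log 2 / 2. The errors are geometric in j
  and sum to O(|z|^2), since |z| is comparable to Re z; then divide by z.\<close>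

lemma logQ_asymp:
  assumes z: "z \<in> sector" and z1: "Re z \<le> 1"
  shows "norm (logQ z - (of_real (pi\<^sup>2 / 12) / z - Ln 2 / 2)) \<le> 16 * norm z"
proof -
  define t where "t = Re z"
  have t: "t > 0" "t \<le> 1" using assms by (auto simp: t_def sector_def)
  have z0: "z \<noteq> 0" using t by (auto simp: t_def)
  define g where "g n = Ln (1 + exp (- (of_nat n * z)))" for n
  define G where "G n = dilog (exp (- (of_nat n * z)))" for n
  have step: "norm (G (Suc j) - G j - z / 2 * (g j + g (Suc j))) \<le> 4 * norm z ^ 3 * exp (- t) ^ j" for j
  proof (cases "j = 0")
    case True
    then show ?thesis using trapezoid_bound_0[OF z] by (simp add: g_def G_def)
  next
    case False
    then have "of_nat j * z \<in> sector" using sector_mult[OF z, of "real j"] by simp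
    from trapezoid_bound[OF this z] show ?thesis
      by (simp add: g_def G_def t_def algebra_simps exp_of_nat_mult[symmetric])
  qed
  have sum_le: "norm (\<Sum>j<n. G (Suc j) - G j - z / 2 * (g j + g (Suc j))) \<le> 4 * norm z ^ 3 / (1 - exp (- t))" for n
  proof -
    have "norm (\<Sum>j<n. G (Suc j) - G j - z / 2 * (g j + g (Suc j))) \<le> (\<Sum>j<n. 4 * norm z ^ 3 * exp (- t) ^ j)"
      by (intro sum_norm_le step)
    also have "\<dots> = 4 * norm z ^ 3 * (\<Sum>j<n. exp (- t) ^ j)" by (simp add: sum_distrib_left)
    also have "\<dots> \<le> 4 * norm z ^ 3 * (1 / (1 - exp (- t)))"
    proof (rule mult_left_mono)
      have "(\<Sum>j<n. exp (- t) ^ j) \<le> (\<Sum>j. exp (- t) ^ j)"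
        using t by (intro sum_le_suminf summable_geometric) auto
      also have "\<dots> = 1 / (1 - exp (- t))" using t by (intro suminf_geometric) auto
      finally show "(\<Sum>j<n. exp (- t) ^ j) \<le> 1 / (1 - exp (- t))" .
    qed simp
    finally show ?thesis by simp
  qed
  \<comment> \<open>Interior nodes are shared by two segments, so only the two end nodes keep weight
    1/2.\<close>
  have sum_eq: "(\<Sum>j<n. G (Suc j) - G j - z / 2 * (g j + g (Suc j))) =
      G n - G 0 - z * ((\<Sum>j<n. g (Suc j)) + g 0 / 2 - g n / 2)" for n
  proof (induction n)
    case (Suc n)
    show ?case unfolding sum.lessThan_Suc Suc.IH by (simp add: field_simps)
  qed (simp add: algebra_simps)
  have e0: "(\<lambda>n. exp (- (of_nat n * z))) \<longlonglongrightarrow> 0" using t by (intro exp_mult_tendsto_0) (auto simp: t_def)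
  have "G \<longlonglongrightarrow> dilog 0" unfolding G_def
    by (rule continuous_on_tendsto_compose[OF continuous_on_dilog e0])
       (use t in \<open>auto intro!: always_eventually simp: t_def\<close>)
  moreover have "(\<lambda>n. \<Sum>j<n. g (Suc j)) \<longlonglongrightarrow> logQ z"
    unfolding logQ_def g_def using t by (intro summable_LIMSEQ summable_logQ) (auto simp: t_def)
  moreover have "g \<longlonglongrightarrow> Ln (1 + 0)"
    unfolding g_def by (intro tendsto_intros e0) auto
  ultimately have "(\<lambda>n. norm (\<Sum>j<n. G (Suc j) - G j - z / 2 * (g j + g (Suc j))))
      \<longlonglongrightarrow> norm (dilog 0 - G 0 - z * (logQ z + g 0 / 2 - Ln (1 + 0) / 2))"
    unfolding sum_eq by (intro tendsto_intros) auto
  then have "norm (dilog 0 - G 0 - z * (logQ z + g 0 / 2 - Ln (1 + 0) / 2)) \<le> 4 * norm z ^ 3 / (1 - exp (- t))"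
    by (rule LIMSEQ_le_const2) (use sum_le in auto)
  then have "norm (of_real (pi\<^sup>2 / 12) - z * (logQ z + Ln 2 / 2)) \<le> 4 * norm z ^ 3 / (1 - exp (- t))"
    by (simp add: dilog_0 dilog_1 G_def g_def)
  \<comment> \<open>1 - e^(-t) \<ge> t/2 for 0 < t \<le> 1; together with |z| \<le> 2t this produces
    the constant 16.\<close>
  also have "\<dots> \<le> 4 * norm z ^ 3 / (t / 2)"
  proof (intro divide_left_mono)
    have "exp (- t) \<le> 1 / (1 + t)"
      using exp_ge_add_one_self[of t] t by (simp add: exp_minus field_simps)
    also have "\<dots> \<le> 1 - t / 2" using t mult_mono[of t 1 t 1] by (simp add: field_simps)
    finally show "t / 2 \<le> 1 - exp (- t)" by simp
    then show "0 < (1 - exp (- t)) * (t / 2)" using t by simp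
  qed simp
  also have "\<dots> = norm z * (8 * norm z * (norm z / t))" by (simp add: power3_eq_cube)
  also have "norm z \<le> 2 * t"
    using cmod_le[of z] z by (auto simp: sector_def t_def)
  then have "norm z * (8 * norm z * (norm z / t)) \<le> norm z * (8 * norm z * 2)"
    using t by (intro mult_left_mono) (auto simp: field_simps)
  finally have "norm (of_real (pi\<^sup>2 / 12) - z * (logQ z + Ln 2 / 2)) \<le> norm z * (16 * norm z)" by simp
  also have "of_real (pi\<^sup>2 / 12) - z * (logQ z + Ln 2 / 2) = - z * (logQ z - (of_real (pi\<^sup>2 / 12) / z - Ln 2 / 2))"
    using z0 by (simp add: field_simps)
  finally show ?thesis using z0 by (simp add: norm_mult)
qed

section \<open>Euler's identity for the odd product\<close>

lemma one_minus_power_neq_0: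
  fixes q :: complex
  assumes "norm q < 1" "j > 0"
  shows "1 - q ^ j \<noteq> 0"
proof
  assume "1 - q ^ j = 0"
  then have "norm q ^ j = 1" by (metis eq_iff_diff_eq_0 norm_one norm_power)
  moreover have "norm q ^ j \<le> norm q ^ 1" using assms by (intro power_decreasing) auto
  ultimately show False using assms by simp
qed

text \<open>Multiply (1 + q^j)(1 - q^j) = 1 - q^(2j) over 1 \<le> j \<le> 2n and split the factors 1
  - q^j into odd and even exponents. With R n the product of 1 - q^(2j) over 1 \<le> j \<le> n, the
  finite identity leaves the quotient R(n)/R(2n), which tends to 1 because R has a nonzero
  limit.\<close>

lemma euler_odd_tendsto:
  assumes "Re z > 0"
  shows "(\<lambda>n. \<Prod>j<n. inverse (1 - exp (- z) ^ (2 * j + 1))) \<longlonglongrightarrow> exp (logQ z)"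
proof -
  define q where "q = exp (- z)"
  have q: "norm q < 1" using assms by (simp add: q_def)
  have nz: "1 - q ^ j \<noteq> 0" if "j > 0" for j by (rule one_minus_power_neq_0[OF q that])
  define R where "R n = (\<Prod>j<n. 1 - q ^ (2 * j + 2))" for n
  have "summable (\<lambda>j. norm (q ^ (2 * j + 2)))"
  proof -
    have "norm (q\<^sup>2) < 1" using q by (simp add: norm_power power_less_one_iff)
    then have "summable (\<lambda>j. norm (q\<^sup>2) * norm (q\<^sup>2) ^ j)" by (intro summable_mult summable_geometric) simp
    also have "(\<lambda>j. norm (q\<^sup>2) * norm (q\<^sup>2) ^ j) = (\<lambda>j. norm (q ^ (2 * j + 2)))"
    proof
      show "norm (q\<^sup>2) * norm (q\<^sup>2) ^ j = norm (q ^ (2 * j + 2))" for j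
        unfolding power_add power_mult norm_mult norm_power by (rule mult.commute)
    qed
    finally show ?thesis .
  qed
  then have "abs_convergent_prod (\<lambda>j. 1 - q ^ (2 * j + 2))"
    by (intro summable_imp_abs_convergent_prod) (simp add: norm_minus_commute)
  then have "convergent_prod (\<lambda>j. 1 - q ^ (2 * j + 2))"
    by (rule abs_convergent_prod_imp_convergent_prod)
  moreover have nz2: "1 - q ^ (2 * j + 2) \<noteq> 0" for j by (rule nz) simp
  ultimately obtain R0 where R0: "(\<lambda>n. \<Prod>j\<le>n. 1 - q ^ (2 * j + 2)) \<longlonglongrightarrow> R0" "R0 \<noteq> 0"
    using convergent_prod_iff_nz_lim[of "\<lambda>j. 1 - q ^ (2 * j + 2)"] by blast
  have R: "R \<longlonglongrightarrow> R0"
    using R0(1) unfolding R_def lessThan_Suc_atMost[symmetric] by (subst (asm) filterlim_sequentially_Suc)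
  have R2: "(\<lambda>n. R (2 * n)) \<longlonglongrightarrow> R0"
    by (rule filterlim_compose[OF R]) (auto intro!: filterlim_subseq simp: strict_mono_def)
  have Rnz: "R n \<noteq> 0" for n using nz2 unfolding R_def prod_zero_iff[OF finite_lessThan] by blast
  have nz1: "1 - q ^ (2 * j + 1) \<noteq> 0" for j by (rule nz) simp
  have eq: "(\<Prod>j<2*n. 1 + q ^ Suc j) * (\<Prod>j<n. 1 - q ^ (2 * j + 1)) * R n = R (2 * n)" for n
  proof (induction n)
    case (Suc n)
    define y where "y = q ^ n"
    have e: "q ^ (n * 2) = y * y" "q ^ (n * 4) = y * y * y * y"
      by (simp_all add: y_def power_mult power2_eq_square power4_eq_xxxx)
    have y: "q ^ (2 * n + 2) = y * y * q * q" "q ^ (2 * n + 1) = y * y * q"  "q ^ Suc (2 * n) = y * y * q"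
      "q ^ Suc (Suc (2 * n)) = y * y * q * q" "q ^ (2 * (2 * n) + 2) = y * y * y * y * q * q"
      "q ^ (2 * Suc (2 * n) + 2) = y * y * y * y * q * q * q * q"
      by (simp_all add: e mult_ac)
    have "(\<Prod>j<2*Suc n. 1 + q ^ Suc j) * (\<Prod>j<Suc n. 1 - q ^ (2 * j + 1)) * R (Suc n) =
      ((\<Prod>j<2*n. 1 + q ^ Suc j) * (\<Prod>j<n. 1 - q ^ (2 * j + 1)) * R n) *
        ((1 + q ^ Suc (2 * n)) * (1 + q ^ Suc (Suc (2 * n))) * (1 - q ^ (2 * n + 1)) * (1 - q ^ (2 * n + 2)))"
      by (simp add: R_def mult_ac del: power_Suc)
    also have "\<dots> = R (2 * n) * ((1 - q ^ (2 * (2 * n) + 2)) * (1 - q ^ (2 * Suc (2 * n) + 2)))"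
      unfolding Suc.IH y by (simp add: algebra_simps)
    also have "\<dots> = R (2 * Suc n)" by (simp add: R_def mult_ac del: power_Suc)
    finally show ?case .
  qed (simp add: R_def)
  have Q: "(\<lambda>n. \<Prod>j<2*n. 1 + q ^ Suc j) \<longlonglongrightarrow> exp (logQ z)"
    unfolding q_def by (rule filterlim_compose[OF prod_tendsto_exp_logQ[OF assms]]) 
       (auto intro!: filterlim_subseq simp: strict_mono_def)
  have "(\<lambda>n. (\<Prod>j<2*n. 1 + q ^ Suc j) * R n / R (2 * n)) \<longlonglongrightarrow> exp (logQ z) * R0 / R0"
    by (intro tendsto_intros Q R R2 R0)
  also have "(\<lambda>n. (\<Prod>j<2*n. 1 + q ^ Suc j) * R n / R (2 * n)) = (\<lambda>n. \<Prod>j<n. inverse (1 - q ^ (2 * j + 1)))"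
  proof
    fix n
    have ab: "b * c / d = inverse e" if "b * e * c = d" "d \<noteq> 0" "e \<noteq> 0" for b c d e :: complex
      using that by (auto simp: field_simps)
    have "(\<Prod>j<n. 1 - q ^ (2 * j + 1)) \<noteq> 0" using nz1 unfolding prod_zero_iff[OF finite_lessThan] by blast
    moreover have "(\<Prod>j<n. inverse (1 - q ^ (2 * j + 1))) = inverse (\<Prod>j<n. 1 - q ^ (2 * j + 1))"
      by (simp add: prod_inversef[unfolded o_def])
    ultimately show "(\<Prod>j<2*n. 1 + q ^ Suc j) * R n / R (2 * n) = (\<Prod>j<n. inverse (1 - q ^ (2 * j + 1)))"
      using eq[of n] Rnz[of "2*n"] ab by metis
  qed
  finally show ?thesis using R0(2) by (simp add: q_def)
qed

section \<open>Evaluation of the power series\<close>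

text \<open>Absolute convergence is part of the notion because products are evaluated as Cauchy
  products.\<close>

definition fps_evals :: "int fps \<Rightarrow> complex \<Rightarrow> complex \<Rightarrow> bool" where
  "fps_evals A q s \<longleftrightarrow>
     summable (\<lambda>n. norm (of_int (fps_nth A n) * q ^ n)) \<and> (\<lambda>n. of_int (fps_nth A n) * q ^ n) sums s"

lemma fps_evals_add: "fps_evals A q s \<Longrightarrow> fps_evals B q t \<Longrightarrow> fps_evals (A + B) q (s + t)"
  unfolding fps_evals_def
proof safe
  assume "summable (\<lambda>n. norm (of_int (fps_nth A n) * q ^ n))" "summable (\<lambda>n. norm (of_int (fps_nth B n) * q ^ n))"
  from summable_add[OF this] show "summable (\<lambda>n. norm (of_int (fps_nth (A + B) n) * q ^ n))"
    by (rule summable_comparison_test') (simp add: distrib_right norm_triangle_ineq)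
qed (simp add: distrib_right sums_add)

lemma fps_evals_uminus: "fps_evals A q s \<Longrightarrow> fps_evals (- A) q (- s)"
  unfolding fps_evals_def by (auto intro: sums_minus)

lemma fps_evals_diff: "fps_evals A q s \<Longrightarrow> fps_evals B q t \<Longrightarrow> fps_evals (A - B) q (s - t)"
  using fps_evals_add[of A q s "- B" "- t"] fps_evals_uminus[of B q t] by simp

lemma fps_evals_X_power: "fps_evals (fps_X ^ m) q (q ^ m)"
proof -
  have "(\<lambda>n. if n = m then q ^ n else 0) sums (q ^ m)" by (rule sums_single)
  moreover have "summable (\<lambda>n. if n = m then norm (q ^ n) else 0)" by (rule summable_single)
  moreover have "(\<lambda>n. of_int (fps_nth (fps_X ^ m) n) * q ^ n) = (\<lambda>n. if n = m then q ^ n else 0)"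
    "(\<lambda>n. norm (of_int (fps_nth (fps_X ^ m) n) * q ^ n)) = (\<lambda>n. if n = m then norm (q ^ n) else 0)"
    by (auto simp: fun_eq_iff fps_X_power_nth)
  ultimately show ?thesis unfolding fps_evals_def by (simp only:)
qed

lemma fps_evals_one: "fps_evals 1 q 1"
  using fps_evals_X_power[of 0 q] by simp

lemma fps_evals_zero: "fps_evals 0 q 0"
  by (simp add: fps_evals_def)

lemma fps_evals_mult:
  assumes "fps_evals A q s" "fps_evals B q t"
  shows "fps_evals (A * B) q (s * t)"
proof -
  define a where "a n = of_int (fps_nth A n) * q ^ n" for n
  define b where "b n = of_int (fps_nth B n) * q ^ n" for n
  have a: "summable (\<lambda>n. norm (a n))" "a sums s" and b: "summable (\<lambda>n. norm (b n))" "b sums t"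
    using assms unfolding fps_evals_def a_def[abs_def] b_def[abs_def] by blast+
  have eq: "of_int (fps_nth (A * B) n) * q ^ n = (\<Sum>i\<le>n. a i * b (n - i))" for n
    by (auto simp: fps_mult_nth a_def b_def sum_distrib_right atLeast0AtMost power_add[symmetric]
             intro!: sum.cong)
  have "(\<lambda>n. \<Sum>i\<le>n. a i * b (n - i)) sums (s * t)"
    using Cauchy_product_sums[OF a(1) b(1)] a(2) b(2) by (simp add: sums_iff)
  moreover have "summable (\<lambda>n. norm (\<Sum>i\<le>n. a i * b (n - i)))"
  proof (rule summable_comparison_test')
    show "summable (\<lambda>n. \<Sum>i\<le>n. norm (a i) * norm (b (n - i)))"
      using summable_Cauchy_product[of "\<lambda>n. norm (a n)" "\<lambda>n. norm (b n)"] a(1) b(1) by simp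
    show "norm (norm (\<Sum>i\<le>n. a i * b (n - i))) \<le> (\<Sum>i\<le>n. norm (a i) * norm (b (n - i)))" for n
      by (simp add: norm_mult[symmetric] norm_sum)
  qed
  ultimately show ?thesis unfolding fps_evals_def eq by blast
qed

lemma fps_evals_power: "fps_evals A q s \<Longrightarrow> fps_evals (A ^ n) q (s ^ n)"
  by (induction n) (auto intro: fps_evals_mult fps_evals_one)

lemma fps_evals_sum: "(\<And>m. m < T \<Longrightarrow> fps_evals (f m) q (g m)) \<Longrightarrow> fps_evals (\<Sum>m<T. f m) q (\<Sum>m<(T::nat). g m)"
  by (induction T) (auto intro: fps_evals_add fps_evals_zero)

lemma fps_evals_geo:
  assumes q: "norm q < 1" and m: "m > 0"
  shows "fps_evals (fps_geo m) q (inverse (1 - q ^ m))"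
proof -
  have sm: "strict_mono (\<lambda>n. m * n)" using m by (auto simp: strict_mono_def)
  have "norm (q ^ m) \<le> norm q ^ 1" unfolding norm_power using q m by (intro power_decreasing) auto
  then have q': "norm (q ^ m) < 1" using q by simp
  have 1: "(\<lambda>n. of_int (fps_nth (fps_geo m) n) * q ^ n) sums inverse (1 - q ^ m)"
  proof (subst sums_mono_reindex[OF sm, symmetric])
    show "(\<lambda>n. of_int (fps_nth (fps_geo m) (m * n)) * q ^ (m * n)) sums inverse (1 - q ^ m)"
      using geometric_sums[OF q'] by (simp add: fps_geo_def power_mult inverse_eq_divide)
  qed (auto simp: fps_geo_def elim!: dvdE)
  have "summable (\<lambda>n. norm q ^ n)" using q by (intro summable_geometric) auto
  then have "summable (\<lambda>n. norm (of_int (fps_nth (fps_geo m) n) * q ^ n))"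
    by (rule summable_comparison_test') (auto simp: fps_geo_def norm_mult norm_power)
  with 1 show ?thesis unfolding fps_evals_def by blast
qed

section \<open>Values of the partial products and of the summands\<close>

definition Sval :: "nat \<Rightarrow> nat \<Rightarrow> complex \<Rightarrow> complex" where
  "Sval a m q = (\<Prod>j<m. 1 + q ^ (2 * j + 2)) ^ a * (\<Prod>j<Suc m. inverse (1 - q ^ (2 * j + 1)))"

lemma fps_evals_Sfps: "norm q < 1 \<Longrightarrow> fps_evals (Sfps a m) q (Sval a m q)"
proof (induction m)
  case 0
  then show ?case using fps_evals_geo[of q 1] by (simp add: Sval_def)
next
  case (Suc m)
  have "fps_evals (Sfps a m * (1 + Xpow m) ^ a * fps_geo (2 * m + 3)) q
      (Sval a m q * (1 + q ^ (2 * m + 2)) ^ a * inverse (1 - q ^ (2 * m + 3)))"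
    unfolding Xpow_def
    by (intro fps_evals_mult fps_evals_power fps_evals_add fps_evals_one fps_evals_X_power
          fps_evals_geo Suc) simp
  moreover have "2 * m + 3 = 2 * Suc m + 1" by simp
  ultimately show ?case by (simp only: Sval_def Sfps.simps prod.lessThan_Suc power_mult_distrib mult_ac)
qed

definition Uval :: "nat \<Rightarrow> nat \<Rightarrow> complex \<Rightarrow> complex" where
  "Uval a m q = (if a = 1 then Sval 1 m q * q ^ (2 * m + 2) / (1 + q ^ (2 * m + 2)) else Sval a m q * q ^ (2 * m + 2))"

lemma fps_evals_Ufps:
  assumes q: "norm q < 1"
  shows "fps_evals (Ufps a m) q (Uval a m q)"
proof -
  define x where "x = q ^ (2 * m + 2)"
  have nz: "1 - x \<noteq> 0" unfolding x_def by (rule one_minus_power_neq_0[OF q]) simp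
  have x4: "q ^ (4 * m + 4) = x * x" unfolding x_def power_add[symmetric] by (rule arg_cong[of _ _ "(^) q"]) simp
  have "fps_evals (Sfps 1 m * (1 - Xpow m) * fps_geo (4 * m + 4) * Xpow m) q
      (Sval 1 m q * (1 - x) * inverse (1 - q ^ (4 * m + 4)) * x)"
    unfolding Xpow_def x_def
    by (intro fps_evals_mult fps_evals_diff fps_evals_one fps_evals_X_power fps_evals_geo fps_evals_Sfps q) simp
  also have "Sval 1 m q * (1 - x) * inverse (1 - q ^ (4 * m + 4)) * x = Sval 1 m q * x / (1 + x)"
  proof -
    have "1 - q ^ (4 * m + 4) = (1 - x) * (1 + x)" unfolding x4 by (simp add: algebra_simps)
    moreover have "b * (1 - x) * inverse ((1 - x) * (1 + x)) * x = b * x / (1 + x)" for b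
      using nz by (simp add: divide_inverse)
    ultimately show ?thesis by (simp only:)
  qed
  finally have 1: "fps_evals (Hfps m * Xpow m) q (Sval 1 m q * x / (1 + x))" by (simp add: Hfps_def)
  have 2: "fps_evals (Sfps a m * Xpow m) q (Sval a m q * x)"
    unfolding Xpow_def x_def by (intro fps_evals_mult fps_evals_X_power fps_evals_Sfps q)
  show ?thesis using 1 2 unfolding Ufps_def Uval_def x_def by auto
qed

lemma prod_even_odd:
  fixes q :: "'a :: comm_ring_1"
  shows "(\<Prod>j<2*n. 1 - q * (- q) ^ j) = (\<Prod>j<n. 1 - q ^ (2 * j + 1)) * (\<Prod>j<n. 1 + q ^ (2 * j + 2))"
proof (induction n)
  case (Suc n)
  have "((- q) ^ n)\<^sup>2 = (q ^ n)\<^sup>2" by (simp add: power_mult[symmetric])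
  then show ?case using Suc by (simp add: mult_ac power_mult)
qed simp

lemma u2_term_conv: "u2_term (Suc m) q = Uval 2 m q"
proof -
  have "(q\<^sup>2) ^ j = q ^ (2 * j)" for j by (simp add: power_mult)
  then have "(\<Prod>j<m. 1 - - (q ^ 2) * (q\<^sup>2) ^ j) = (\<Prod>j<m. 1 + q ^ (2 * j + 2))"
    "(\<Prod>j<Suc m. 1 - q * (q\<^sup>2) ^ j) = (\<Prod>j<Suc m. 1 - q ^ (2 * j + 1))"
    by (simp_all add: power_add mult_ac power2_eq_square)
  then show ?thesis
    unfolding u2_term_def Uval_def Sval_def qpochhammer_def prod_inversef[unfolded o_def]
    by (simp add: divide_inverse mult_ac del: prod.lessThan_Suc)
qed

lemma u2bar_term_conv:
  assumes q: "norm q < 1"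
  shows "u2bar_term (Suc m) q = Uval 1 m q"
proof -
  define E where "E = (\<Prod>j<m. 1 + q ^ (2 * j + 2))"
  \<comment> \<open>A zero would make q a root of unity; nonvanishing permits cancelling one of the
    two copies of E against the denominator.\<close>
  have "1 + q ^ (2 * j + 2) \<noteq> 0" for j
  proof
    assume "1 + q ^ (2 * j + 2) = 0"
    then have "q ^ (2 * j + 2) = - 1" by (simp only: add_eq_0_iff)
    then have "q ^ ((2 * j + 2) * 2) = 1" unfolding power_mult by simp
    then show False using one_minus_power_neq_0[OF q, of "(2 * j + 2) * 2"] by simp
  qed
  then have nz: "E \<noteq> 0" "1 + q ^ (2 * m + 2) \<noteq> 0" unfolding E_def prod_zero_iff[OF finite_lessThan] by blast+
  have "(q\<^sup>2) ^ j = q ^ (2 * j)" for j by (simp add: power_mult)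
  then have 1: "(\<Prod>j<m. 1 - - (q ^ 2) * (q\<^sup>2) ^ j) = E"
    by (simp_all add: E_def power_add mult_ac power2_eq_square)
  have 2: "(\<Prod>j<Suc m. 1 + q ^ (2 * j + 2)) = E * (1 + q ^ (2 * m + 2))" by (simp add: E_def)
  have 3: "2 * Suc m = 2 * m + 2" by simp
  have "u2bar_term (Suc m) q =
      E\<^sup>2 * q ^ (2 * m + 2) / ((\<Prod>j<Suc m. 1 - q ^ (2 * j + 1)) * (E * (1 + q ^ (2 * m + 2))))"
    unfolding u2bar_term_def qpochhammer_def prod_even_odd diff_Suc_1 1 2 by (simp only: 3)
  also have "\<dots> = Uval 1 m q"
    unfolding Uval_def Sval_def prod_inversef[unfolded o_def] E_def[symmetric] using nz
    by (simp add: divide_inverse mult_ac power2_eq_square del: prod.lessThan_Suc)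
  finally show ?thesis .
qed

text \<open>For |q| < r < 1 the value at r bounds every partial sum of c_n r^n, since all
  coefficients are nonnegative and those up to T are final in \<open>A T\<close>. The summable
  sequence c_n r^n then dominates, and Tannery's theorem applies at q.\<close>

lemma nonneg_fps_limit:
  fixes A :: "nat \<Rightarrow> int fps"
  assumes nonneg: "\<And>T. fps_nonneg (A T)"
    and mono: "\<And>T n. fps_nth (A T) n \<le> fps_nth (A (Suc T)) n"
    and stable: "\<And>n T. n \<le> T \<Longrightarrow> fps_nth (A T) n = c n"
    and ev: "\<And>q T. norm q < 1 \<Longrightarrow> fps_evals (A T) q (s T q)"
    and bd: "\<And>r. 0 < r \<Longrightarrow> r < 1 \<Longrightarrow> \<exists>C. \<forall>T. norm (s T (of_real r)) \<le> C"
    and q: "norm q < 1"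
  shows "summable (\<lambda>n. norm (of_int (c n) * q ^ n))"
    and "(\<lambda>T. s T q) \<longlonglongrightarrow> (\<Sum>n. of_int (c n) * q ^ n)"
proof -
  obtain r where r: "norm q < r" "r < 1" using dense[OF q] by blast
  then have r0: "0 < r" using norm_ge_zero[of q] by linarith
  obtain C where C: "\<And>T. norm (s T (of_real r)) \<le> C" using bd[OF r0 r(2)] by blast
  have c_le: "fps_nth (A T) n \<le> c n" for T n
  proof (cases "T \<le> n")
    case True
    have "fps_nth (A T) n \<le> fps_nth (A n) n"
      using lift_Suc_mono_le[of "\<lambda>T. fps_nth (A T) n", OF mono True] .
    then show ?thesis by (simp add: stable)
  qed (simp add: stable)
  have c_nonneg: "0 \<le> c n" for n using nonneg[of n] stable[of n n] unfolding fps_nonneg_def by (metis order_refl)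
  have sr: "summable (\<lambda>n. real_of_int (c n) * r ^ n)"
  proof (rule bounded_imp_summable)
    show "0 \<le> real_of_int (c n) * r ^ n" for n using c_nonneg r0 by simp
    show "(\<Sum>n\<le>T. real_of_int (c n) * r ^ n) \<le> C" for T
    proof -
      define f where "f n = real_of_int (fps_nth (A T) n) * r ^ n" for n
      have f0: "0 \<le> f n" for n using nonneg[of T] r0 by (auto simp: f_def fps_nonneg_def)
      have "fps_evals (A T) (of_real r) (s T (of_real r))" using r r0 by (intro ev) simp
      then have *: "(\<lambda>n. complex_of_real (f n)) sums s T (of_real r)"
        "summable (\<lambda>n. norm (complex_of_real (f n)))" by (auto simp: fps_evals_def f_def)
      have sf: "summable f" using *(2) f0 by simp
      then have "(\<lambda>n. complex_of_real (f n)) sums of_real (suminf f)"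
        by (intro sums_of_real summable_sums)
      then have "s T (of_real r) = of_real (suminf f)" using *(1) by (metis sums_unique2)
      then have "suminf f = norm (s T (of_real r))" using suminf_nonneg[OF sf f0] by simp
      moreover have "(\<Sum>n\<le>T. real_of_int (c n) * r ^ n) = sum f {..T}"
        by (intro sum.cong) (auto simp: f_def stable)
      moreover have "sum f {..T} \<le> suminf f" using sf f0 by (intro sum_le_suminf) auto
      ultimately show ?thesis using C[of T] by linarith
    qed
  qed
  have le: "norm (of_int (fps_nth (A T) n) * q ^ n) \<le> real_of_int (c n) * r ^ n" for n T
    using c_le[of T n] c_nonneg[of n] nonneg[of T] r
    by (auto simp: norm_mult norm_power fps_nonneg_def intro!: mult_mono power_mono)
  have "eventually (\<lambda>T. summable (\<lambda>n. norm (of_int (fps_nth (A T) n) * q ^ n))) sequentially \<and>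
      summable (\<lambda>n. norm (of_int (c n) * q ^ n)) \<and>
      (\<lambda>T. \<Sum>n. of_int (fps_nth (A T) n) * q ^ n) \<longlonglongrightarrow> (\<Sum>n. of_int (c n) * q ^ n)"
  proof (rule tannerys_theorem[OF _ _ sr])
    show "(\<lambda>T. of_int (fps_nth (A T) n) * q ^ n) \<longlonglongrightarrow> of_int (c n) * q ^ n" for n
      by (rule tendsto_eventually) (use stable in \<open>auto simp: eventually_at_top_linorder intro!: exI[of _ n]\<close>)
    show "\<forall>\<^sub>F (n, T) in sequentially \<times>\<^sub>F sequentially. norm (of_int (fps_nth (A T) n) * q ^ n) \<le> real_of_int (c n) * r ^ n"
      using le by (intro always_eventually) auto
  qed simp
  moreover have "(\<Sum>n. of_int (fps_nth (A T) n) * q ^ n) = s T q" for T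
    using ev[OF q, of T] by (auto simp: fps_evals_def sums_iff)
  ultimately show "summable (\<lambda>n. norm (of_int (c n) * q ^ n))"
    and "(\<lambda>T. s T q) \<longlonglongrightarrow> (\<Sum>n. of_int (c n) * q ^ n)" by auto
qed

text \<open>P at q = e^(-z): by Euler the reciprocal odd product is the product of all 1 + q^j and
  contributes \<open>logQ z\<close>; the even factors contribute \<open>logQ (2 * z)\<close> with
  multiplicity a.\<close>

definition Pfun :: "nat \<Rightarrow> complex \<Rightarrow> complex" where
  "Pfun a z = exp (logQ (2 * z)) ^ a * exp (logQ z)"

lemma Sval_tendsto:
  assumes "Re z > 0"
  shows "(\<lambda>m. Sval a m (exp (- z))) \<longlonglongrightarrow> Pfun a z"
proof -
  have "exp (- (2 * z)) = exp (- z) ^ 2"  by (simp add: exp_of_nat_mult[of 2, symmetric])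
  then have "exp (- (2 * z)) ^ Suc j = exp (- z) ^ (2 * j + 2)" for j
    by (simp only: power_mult[symmetric]) simp
  with prod_tendsto_exp_logQ[of "2 * z"] assms 
  have 1: "(\<lambda>m. \<Prod>j<m. 1 + exp (- z) ^ (2 * j + 2)) \<longlonglongrightarrow> exp (logQ (2 * z))"
    by (simp only:) simp
  show ?thesis unfolding Sval_def Pfun_def
    by (intro tendsto_intros 1 LIMSEQ_Suc[OF euler_odd_tendsto[OF assms]])
qed

lemma Sval_bounded:
  assumes "0 < r" "r < 1"
  shows "\<exists>C. \<forall>T. norm (Sval a T (of_real r)) \<le> C"
proof -
  have "exp (- complex_of_real (- ln r)) = of_real r"
    using assms by (simp add: exp_of_real)
  with Sval_tendsto[of "of_real (- ln r)" a] assms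
  have "(\<lambda>m. Sval a m (of_real r)) \<longlonglongrightarrow> Pfun a (of_real (- ln r))" by simp
  then have "Bseq (\<lambda>m. Sval a m (of_real r))" by (rule convergent_imp_Bseq[OF convergentI])
  then show ?thesis by (auto simp: Bseq_def)
qed

lemma pcoeff_sums:
  assumes a: "a \<in> {1, 2}" and z: "Re z > 0"
  shows "summable (\<lambda>n. norm (of_int (pcoeff a n) * exp (- z) ^ n))"
    and "(\<lambda>n. of_int (pcoeff a n) * exp (- z) ^ n) sums Pfun a z"
proof -
  have mono: "fps_nth (Sfps a T) n \<le> fps_nth (Sfps a (Suc T)) n" for T n
  proof -
    have "fps_nonneg (Sfps a (Suc T) - Sfps a T)"
      unfolding Sfps_diff[OF a] by (intro nonneg_intros Bfps_nonneg)
    then show ?thesis by (auto simp: fps_nonneg_def)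
  qed
  have q: "norm (exp (- z)) < 1" using z by simp
  note L = nonneg_fps_limit[of "Sfps a" "pcoeff a" "Sval a", OF Sfps_nonneg mono Sfps_nth[OF a] fps_evals_Sfps Sval_bounded q]
  show s: "summable (\<lambda>n. norm (of_int (pcoeff a n) * exp (- z) ^ n))" by (rule L(1))
  have "(\<Sum>n. of_int (pcoeff a n) * exp (- z) ^ n) = Pfun a z"
    by (rule LIMSEQ_unique[OF L(2) Sval_tendsto[OF z]])
  then show "(\<lambda>n. of_int (pcoeff a n) * exp (- z) ^ n) sums Pfun a z"
    using summable_norm_cancel[OF s] by (simp add: sums_iff)
qed

lemma ucoeff_sums:
  assumes q: "norm q < 1"
  shows "(\<lambda>m. Uval a m q) sums (\<Sum>n. of_int (ucoeff a n) * q ^ n)"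
    and "summable (\<lambda>n. of_int (ucoeff a n) * q ^ n)"
proof -
  have mono: "fps_nth (\<Sum>m<T. Ufps a m) n \<le> fps_nth (\<Sum>m<Suc T. Ufps a m) n" for T n
    using Ufps_nonneg[of a T] by (simp add: fps_nonneg_def)
  have bd: "\<exists>C. \<forall>T. norm (\<Sum>m<T. Uval a m (of_real r)) \<le> C" if r: "0 < r" "r < 1" for r
  proof -
    obtain C where C: "\<And>T. norm (Sval a T (of_real r)) \<le> C" using Sval_bounded[OF r] by blast
    have C0: "0 \<le> C" using C[of 0] norm_ge_zero order_trans by blast
    \<comment> \<open>The crude r^(2m+2) \<le> r^m suffices for a geometric majorant; for a = 1 the
      denominator 1 + x \<ge> 1 is dropped.\<close>
    have le: "norm (Uval a m (of_real r)) \<le> C * r ^ m" for m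
    proof -
      define x where "x = r ^ (2 * m + 2)"
      have x: "0 < x" using r by (simp add: x_def)
      have xr: "x \<le> r ^ m" unfolding x_def using r by (intro power_decreasing) auto
      have "norm (1 + complex_of_real x) = 1 + x"
        using x by (metis norm_of_real of_real_1 of_real_add abs_of_pos add_pos_pos zero_less_one)
      then have *: "norm (y * of_real x / (1 + complex_of_real x)) \<le> norm y * x" for y
        using x by (simp add: norm_mult norm_divide divide_le_eq_1 mult_left_le field_simps)
      have "complex_of_real r ^ (2 * m + 2) = of_real x" by (simp add: x_def)
      then have "norm (Uval a m (of_real r)) \<le> norm (Sval a m (of_real r)) * x"
        unfolding Uval_def using *[of "Sval 1 m (of_real r)"] x by (auto simp: norm_mult)
      also have "\<dots> \<le> C * r ^ m" using C[of m] x xr C0 by (intro mult_mono) auto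
      finally show ?thesis .
    qed
    have "norm (\<Sum>m<T. Uval a m (of_real r)) \<le> C * (1 / (1 - r))" for T
    proof -
      have "norm (\<Sum>m<T. Uval a m (of_real r)) \<le> (\<Sum>m<T. C * r ^ m)" by (intro sum_norm_le le)
      also have "\<dots> = C * (\<Sum>m<T. r ^ m)" by (simp add: sum_distrib_left)
      also have "(\<Sum>m<T. r ^ m) \<le> (\<Sum>m. r ^ m)"
        using r by (intro sum_le_suminf summable_geometric) auto
      also have "(\<Sum>m. r ^ m) = 1 / (1 - r)" using r by (intro suminf_geometric) auto
      finally show ?thesis using C0 by (simp add: mult_left_mono)
    qed
    then show ?thesis by blast
  qed
  note L = nonneg_fps_limit[of "\<lambda>T. \<Sum>m<T. Ufps a m" "ucoeff a" "\<lambda>T q. \<Sum>m<T. Uval a m q",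
      OF _ mono Ufps_sum_nth _ bd q]
  show "(\<lambda>m. Uval a m q) sums (\<Sum>n. of_int (ucoeff a n) * q ^ n)"
    unfolding sums_def by (rule L(2)) (auto intro!: fps_nonneg_sum Ufps_nonneg fps_evals_sum fps_evals_Ufps)
  show "summable (\<lambda>n. of_int (ucoeff a n) * q ^ n)"
    by (rule summable_norm_cancel, rule L(1)) (auto intro!: fps_nonneg_sum Ufps_nonneg fps_evals_sum fps_evals_Ufps)
qed

text \<open>The coefficients are introduced by a definite description, which asks for uniqueness
  besides existence. Convergence at 1/2 gives a positive radius, and the identity theorem for power
  series applies.\<close>

lemma has_power_series_coeffs_unique:
  assumes "has_power_series_coeffs t u" "has_power_series_coeffs t v"
  shows "u = v"
proof -
  define F where "F w = Abs_fps (\<lambda>n. complex_of_int (w n))" for w :: "nat \<Rightarrow> int"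
  have sums: "\<exists>S. (\<lambda>n. of_int (u n) * q ^ n) sums S \<and> (\<lambda>n. of_int (v n) * q ^ n) sums S"
    if "norm q < 1" for q :: complex
    using assms that unfolding has_power_series_coeffs_def by (metis sums_unique2)
  have rad: "fps_conv_radius (F w) > 0" if "w = u \<or> w = v" for w
  proof -
    have "summable (\<lambda>n. of_int (w n) * (1 / 2 :: complex) ^ n)"
      using sums[of "1 / 2"] that by (auto simp: sums_iff norm_divide)
    then have "conv_radius (\<lambda>n. complex_of_int (w n)) \<ge> ereal (norm (1 / 2 :: complex))"
      by (rule conv_radius_geI)
    then have "fps_conv_radius (F w) \<ge> ereal (1 / 2)" by (simp add: fps_conv_radius_def F_def norm_divide)
    then show ?thesis by (rule less_le_trans[rotated]) simp
  qed
  have "\<forall>\<^sub>F q in nhds 0. eval_fps (F u) q = eval_fps (F v) q"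
  proof -
    have "\<forall>\<^sub>F q in nhds (0::complex). q \<in> ball 0 1" by (intro eventually_nhds_in_open) auto
    then show ?thesis
    proof eventually_elim
      case (elim q)
      then show ?case using sums[of q] by (auto simp: eval_fps_def F_def sums_iff)
    qed
  qed
  then have "F u = F v" using rad by (intro eval_fps_eqD) auto
  then show "u = v" by (auto simp: F_def fps_eq_iff)
qed

lemma has_power_series_coeffs_u2: "has_power_series_coeffs u2_term (ucoeff 2)"
  unfolding has_power_series_coeffs_def u2_term_conv using ucoeff_sums by (blast intro: summable_sums)

lemma has_power_series_coeffs_u2bar: "has_power_series_coeffs u2bar_term (ucoeff 1)"
  unfolding has_power_series_coeffs_def
proof safe
  fix q :: complex assume q: "norm q < 1"
  show "\<exists>S. (\<lambda>n. u2bar_term (Suc n) q) sums S \<and> (\<lambda>n. of_int (ucoeff 1 n) * q ^ n) sums S"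
    unfolding u2bar_term_conv[OF q] using ucoeff_sums[OF q] by (blast intro: summable_sums)
qed

lemma u2_eq: "u2 = ucoeff 2"
  unfolding u2_def using has_power_series_coeffs_u2 has_power_series_coeffs_unique by blast

lemma u2bar_eq: "u2bar = ucoeff 1"
  unfolding u2bar_def using has_power_series_coeffs_u2bar has_power_series_coeffs_unique by blast

section \<open>The circle method\<close>

text \<open>With s = |w| one has |1 - w|^2 = (1 - s)^2 + 2 (s - Re w). The excess is recast as an
  exponential so that the gains of infinitely many factors add up; exp(e/2) \<le> 1 + 2e holds
  because e = s - Re w is at most 2.\<close>

lemma norm_inverse_one_minus_le:
  fixes w :: complex
  assumes "norm w < 1"
  shows "norm (inverse (1 - w)) \<le> inverse (1 - norm w) * exp (- ((norm w - Re w) / 4))"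
proof -
  define s where "s = norm w"
  define e where "e = s - Re w"
  have s: "0 \<le> s" "s < 1" using assms by (auto simp: s_def)
  have e: "0 \<le> e" "e \<le> 2"
    using complex_Re_le_cmod[of w] abs_Re_le_cmod[of w] s by (auto simp: e_def s_def)
  have "exp (e / 2) \<le> 1 + e / 2 + (e / 2)\<^sup>2" using e by (intro exp_bound) auto
  also have "\<dots> \<le> 1 + 2 * e" using mult_mono[of e 2 e e] e by (simp add: power2_eq_square field_simps)
  finally have "(1 - s)\<^sup>2 * exp (e / 2) \<le> (1 - s)\<^sup>2 * (1 + 2 * e)" by (intro mult_left_mono) auto
  also have "\<dots> \<le> (1 - s)\<^sup>2 + 2 * e"
    using mult_right_mono[of "(1 - s)\<^sup>2" 1 "2 * e"] s e by (simp add: algebra_simps power_le_one)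
  also have "\<dots> = (norm (1 - w))\<^sup>2"
    by (simp add: e_def s_def cmod_power2 power2_diff)
  finally have *: "(1 - s)\<^sup>2 * exp (e / 2) \<le> (norm (1 - w))\<^sup>2" .
  have "((1 - s) * exp (e / 4))\<^sup>2 = (1 - s)\<^sup>2 * exp (e / 2)"
    by (simp add: power_mult_distrib exp_double[symmetric])
  then have "((1 - s) * exp (e / 4))\<^sup>2 \<le> (norm (1 - w))\<^sup>2" using * by (simp only:)
  then have "(1 - s) * exp (e / 4) \<le> norm (1 - w)" by (rule power2_le_imp_le) simp
  then have "inverse (norm (1 - w)) \<le> inverse ((1 - s) * exp (e / 4))"
    using s by (intro le_imp_inverse_le) auto
  then show ?thesis by (simp add: norm_inverse s_def e_def exp_minus)
qed

lemma norm_Sval_of_real: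
  assumes "0 < r" "r < 1"
  shows "norm (Sval a m (of_real r)) =
    (\<Prod>j<m. 1 + r ^ (2 * j + 2)) ^ a * (\<Prod>j<Suc m. inverse (1 - r ^ (2 * j + 1)))"
proof -
  have "r ^ (2 * j + 1) < 1" for j using assms by (intro power_less_one_iff[THEN iffD2]) auto
  then have "0 \<le> (\<Prod>j<m. 1 + r ^ (2 * j + 2)) ^ a * (\<Prod>j<Suc m. inverse (1 - r ^ (2 * j + 1)))"
    using assms by (intro mult_nonneg_nonneg zero_le_power prod_nonneg ballI) (auto intro!: less_imp_le add_pos_pos)
  moreover have "Sval a m (of_real r) =
    of_real ((\<Prod>j<m. 1 + r ^ (2 * j + 2)) ^ a * (\<Prod>j<Suc m. inverse (1 - r ^ (2 * j + 1))))"
    by (simp add: Sval_def)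
  ultimately show ?thesis by (simp only: norm_of_real abs_of_nonneg)
qed

text \<open>The even factors are bounded by the triangle inequality alone; all decay comes from the
  odd ones.\<close>

lemma norm_Sval_le:
  assumes q: "q \<noteq> 0" "norm q < 1"
  shows "norm (Sval a m q) \<le> norm (Sval a m (of_real (norm q))) *
     exp (- ((\<Sum>j<Suc m. norm q ^ (2 * j + 1) - Re (q ^ (2 * j + 1))) / 4))"
proof -
  define r where "r = norm q"
  have r: "0 < r" "r < 1" using q by (auto simp: r_def)
  have r1: "r ^ (2 * j + 1) < 1" for j using r by (intro power_less_one_iff[THEN iffD2]) auto
  have 1: "norm (\<Prod>j<m. 1 + q ^ (2 * j + 2)) \<le> (\<Prod>j<m. 1 + r ^ (2 * j + 2))"
    unfolding prod_norm[symmetric] r_def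
    by (intro prod_mono conjI norm_ge_zero order.trans[OF norm_triangle_ineq]) (simp add: norm_power norm_mult)
  have "norm (\<Prod>j<Suc m. inverse (1 - q ^ (2 * j + 1)))
      \<le> (\<Prod>j<Suc m. inverse (1 - r ^ (2 * j + 1)) * exp (- ((r ^ (2 * j + 1) - Re (q ^ (2 * j + 1))) / 4)))"
    unfolding prod_norm[symmetric]
  proof (intro prod_mono conjI norm_ge_zero)
    fix j
    have "norm (q ^ (2 * j + 1)) = r ^ (2 * j + 1)" by (simp only: norm_power r_def)
    then show "norm (inverse (1 - q ^ (2 * j + 1))) \<le> inverse (1 - r ^ (2 * j + 1)) * exp (- ((r ^ (2 * j + 1) - Re (q ^ (2 * j + 1))) / 4))"
      using norm_inverse_one_minus_le[of "q ^ (2 * j + 1)"] r1[of j] by (simp only:)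
  qed
  also have "\<dots> = (\<Prod>j<Suc m. inverse (1 - r ^ (2 * j + 1))) *
      exp (- ((\<Sum>j<Suc m. r ^ (2 * j + 1) - Re (q ^ (2 * j + 1))) / 4))"
    by (simp only: prod.distrib exp_sum[OF finite_lessThan, symmetric] sum_negf sum_divide_distrib)
  finally have 2: "norm (\<Prod>j<Suc m. inverse (1 - q ^ (2 * j + 1))) \<le> (\<Prod>j<Suc m. inverse (1 - r ^ (2 * j + 1))) *
      exp (- ((\<Sum>j<Suc m. r ^ (2 * j + 1) - Re (q ^ (2 * j + 1))) / 4))" .
  have "norm (Sval a m q) \<le> (\<Prod>j<m. 1 + r ^ (2 * j + 2)) ^ a * ((\<Prod>j<Suc m. inverse (1 - r ^ (2 * j + 1))) *
      exp (- ((\<Sum>j<Suc m. r ^ (2 * j + 1) - Re (q ^ (2 * j + 1))) / 4)))"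
    unfolding Sval_def norm_mult norm_power
    using r by (intro mult_mono[OF power_mono[OF 1] 2] zero_le_power prod_nonneg ballI norm_ge_zero) (auto intro!: add_nonneg_nonneg)
  then show ?thesis unfolding r_def[symmetric] norm_Sval_of_real[OF r] by (simp only: mult.assoc)
qed

lemma odd_powers_sums:
  fixes q :: "'a :: {real_normed_field, banach}"
  assumes "norm q < 1"
  shows "(\<lambda>j. q ^ (2 * j + 1)) sums (q / (1 - q\<^sup>2))"
proof -
  have "norm (q\<^sup>2) < 1" using assms by (simp add: norm_power power_less_one_iff)
  then have "(\<lambda>j. q * (q\<^sup>2) ^ j) sums (q * (1 / (1 - q\<^sup>2)))" by (intro sums_mult geometric_sums)
  then show ?thesis by (simp add: power_mult)
qed

text \<open>The odd powers of q sum to q/(1 - q^2), so the total gain is the drop in the real part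
  of this function from |q| to q.\<close>

lemma norm_Pfun_le:
  assumes "Re z > 0"
  defines "q \<equiv> exp (- z)" and "r \<equiv> exp (- Re z)"
  shows "norm (Pfun a z) \<le> norm (Pfun a (of_real (Re z))) * exp (- ((r / (1 - r\<^sup>2) - Re (q / (1 - q\<^sup>2))) / 4))"
proof (rule LIMSEQ_le)
  have r: "norm q = r" "0 < r" "r < 1" using assms by (auto simp: q_def r_def)
  show "(\<lambda>m. norm (Sval a m q)) \<longlonglongrightarrow> norm (Pfun a z)"
    unfolding q_def by (intro tendsto_norm Sval_tendsto assms)
  have "(\<lambda>j. Re (q ^ (2 * j + 1))) sums Re (q / (1 - q\<^sup>2))"
    using r by (intro sums_Re odd_powers_sums) simp
  moreover have "(\<lambda>j. r ^ (2 * j + 1)) sums (r / (1 - r\<^sup>2))"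
    using r by (intro odd_powers_sums) simp
  ultimately have "(\<lambda>j. r ^ (2 * j + 1) - Re (q ^ (2 * j + 1))) sums (r / (1 - r\<^sup>2) - Re (q / (1 - q\<^sup>2)))"
    by (intro sums_diff)
  then have s: "(\<lambda>m. \<Sum>j<Suc m. r ^ (2 * j + 1) - Re (q ^ (2 * j + 1))) \<longlonglongrightarrow> r / (1 - r\<^sup>2) - Re (q / (1 - q\<^sup>2))"
    unfolding sums_def by (rule LIMSEQ_Suc)
  have "complex_of_real r = exp (- of_real (Re z))" unfolding r_def exp_of_real[symmetric] by simp
  then have "(\<lambda>m. Sval a m (of_real r)) \<longlonglongrightarrow> Pfun a (of_real (Re z))"
    using Sval_tendsto[of "of_real (Re z)" a] assms by simp
  then show "(\<lambda>m. norm (Sval a m (of_real r)) * exp (- ((\<Sum>j<Suc m. r ^ (2 * j + 1) - Re (q ^ (2 * j + 1))) / 4)))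
      \<longlonglongrightarrow> norm (Pfun a (of_real (Re z))) * exp (- ((r / (1 - r\<^sup>2) - Re (q / (1 - q\<^sup>2))) / 4))"
    by (intro tendsto_intros s) auto
  show "\<exists>N. \<forall>m\<ge>N. norm (Sval a m q) \<le> norm (Sval a m (of_real r)) *
      exp (- ((\<Sum>j<Suc m. r ^ (2 * j + 1) - Re (q ^ (2 * j + 1))) / 4))"
    using norm_Sval_le[of q a] r by (auto simp del: sum.lessThan_Suc)
qed

text \<open>Multiplying by the conjugate gives |1 - q^2|^2 = D^2 + 4 (Im q)^2 below and the real
  part Re q (1 - |q|^2) above.\<close>

lemma Re_over_one_minus_square:
  fixes q :: complex
  defines "D \<equiv> 1 - (norm q)\<^sup>2"
  shows "Re (q / (1 - q\<^sup>2)) = Re q * D / (D\<^sup>2 + 4 * (Im q)\<^sup>2)"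
proof -
  define u v where "u = Re q" and "v = Im q"
  have D: "D = 1 - u\<^sup>2 - v\<^sup>2" by (simp add: D_def cmod_power2 u_def v_def)
  have re: "Re (1 - q\<^sup>2) = 1 - u\<^sup>2 + v\<^sup>2" and im: "Im (1 - q\<^sup>2) = - 2 * u * v"
    by (auto simp: u_def v_def power2_eq_square)
  have "Re (q / (1 - q\<^sup>2)) = (u * (1 - u\<^sup>2 + v\<^sup>2) + v * (- 2 * u * v)) / ((1 - u\<^sup>2 + v\<^sup>2)\<^sup>2 + (- 2 * u * v)\<^sup>2)"
    by (simp only: Re_divide re im u_def[symmetric] v_def[symmetric])
  also have "u * (1 - u\<^sup>2 + v\<^sup>2) + v * (- 2 * u * v) = u * D"
    by (simp add: D algebra_simps power2_eq_square)
  also have "(1 - u\<^sup>2 + v\<^sup>2)\<^sup>2 + (- 2 * u * v)\<^sup>2 = D\<^sup>2 + 4 * v\<^sup>2"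
    by (simp add: D algebra_simps power2_eq_square)
  finally show ?thesis by (simp add: u_def v_def)
qed

lemma sin_square_ge:
  assumes "\<bar>y\<bar> \<le> pi / 2"
  shows "(sin y)\<^sup>2 \<ge> y\<^sup>2 / 9"
proof -
  have y: "\<bar>y\<bar> \<le> 2" using assms pi_less_4 by simp
  have "\<bar>sin y - y\<bar> \<le> \<bar>y\<bar> ^ 3 / 6"
    using Maclaurin_sin_bound[of y 3] by (simp add: sin_coeff_def eval_nat_numeral)
  \<comment> \<open>|y| \<le> 2 turns the remainder |y|^3/6 into 2|y|/3, which leaves |sin y| \<ge>
    |y|/3.\<close>
  moreover have "\<bar>y\<bar> ^ 3 \<le> 4 * \<bar>y\<bar>"
  proof -
    have "\<bar>y\<bar> * (\<bar>y\<bar> * \<bar>y\<bar>) \<le> \<bar>y\<bar> * (2 * 2)" using y by (intro mult_left_mono mult_mono) auto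
    then show ?thesis by (simp add: power3_eq_cube)
  qed
  ultimately have "\<bar>y\<bar> / 3 \<le> \<bar>sin y\<bar>" by linarith
  then have "(\<bar>y\<bar> / 3)\<^sup>2 \<le> \<bar>sin y\<bar>\<^sup>2" by (intro power_mono) auto
  then show ?thesis by (simp add: power_divide)
qed

text \<open>For |y| \<le> pi/2 the gain is at least r/D times x/(D^2 + x) with x = 4 (r sin y)^2;
  for larger |y| the cosine is nonpositive and at least the full r/D is gained, which covers the
  neighbourhood of q = -1. The 600 is 6, from r/D \<ge> 1/(6t), times 100 from the quotient.\<close>

lemma gain_ge:
  assumes t: "0 < t" "t \<le> 1" and y: "\<bar>y\<bar> \<le> pi"
  defines "q \<equiv> exp (- Complex t y)" and "r \<equiv> exp (- t)"
  shows "r / (1 - r\<^sup>2) - Re (q / (1 - q\<^sup>2)) \<ge> y\<^sup>2 / (600 * t * (t\<^sup>2 + y\<^sup>2))"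
proof -
  define D where "D = 1 - r\<^sup>2"
  have nq: "norm q = r" by (simp add: q_def r_def)
  have r2: "r\<^sup>2 = exp (- 2 * t)" by (simp add: r_def exp_double[symmetric])
  have D: "0 < D" "D \<le> 2 * t" using t exp_ge_add_one_self[of "- 2 * t"] by (auto simp: D_def r2)
  have "1 / 3 \<le> exp (- 1 :: real)" using exp_le by (simp add: exp_minus field_simps)
  also have "\<dots> \<le> r" using t by (simp add: r_def)
  finally have r: "1 / 3 \<le> r" .
  have Req: "Re q = r * cos y" and Imq: "Im q = - r * sin y" by (auto simp: q_def r_def Re_exp Im_exp)
  have Re: "Re (q / (1 - q\<^sup>2)) = r * cos y * D / (D\<^sup>2 + 4 * (r * sin y)\<^sup>2)"
    unfolding Re_over_one_minus_square nq D_def Req Imq by (simp add: power_mult_distrib)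
  have rD: "r / D \<ge> 1 / (6 * t)"
    using frac_le[of r "1/3" D "2 * t"] r D t by (simp add: field_simps)
  show ?thesis
  proof (cases "\<bar>y\<bar> \<le> pi / 2")
    case True
    define x where "x = 4 * (r * sin y)\<^sup>2"
    have x0: "0 \<le> x" by (simp add: x_def)
    have "(1 / 3)\<^sup>2 * (y\<^sup>2 / 9) \<le> r\<^sup>2 * (sin y)\<^sup>2"
      using r sin_square_ge[OF True] by (intro mult_mono power_mono) auto
    then have "y\<^sup>2 / 81 \<le> (r * sin y)\<^sup>2" by (simp add: power_divide power_mult_distrib)
    \<comment> \<open>The factor 4/81 is relaxed to 1/25.\<close>
    then have x: "y\<^sup>2 / 25 \<le> x" unfolding x_def using zero_le_power2[of y] by linarith
    have "r * cos y * D / (D\<^sup>2 + x) \<le> r * 1 * D / (D\<^sup>2 + x)"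
      using r D x0 by (intro divide_right_mono mult_right_mono mult_left_mono) auto
    also have "\<dots> = r / D - r / D * (x / (D\<^sup>2 + x))"
    proof -
      have "D\<^sup>2 + x > 0" using D x0 by (intro add_pos_nonneg) auto
      then have "x / (D\<^sup>2 + x) = 1 - D\<^sup>2 / (D\<^sup>2 + x)" by (simp add: field_simps)
      then show ?thesis using D by (simp add: right_diff_distrib power2_eq_square)
    qed
    finally have 1: "r / (1 - r\<^sup>2) - Re (q / (1 - q\<^sup>2)) \<ge> r / D * (x / (D\<^sup>2 + x))"
      unfolding Re D_def[symmetric] x_def[symmetric] by simp
    have 2: "x / (D\<^sup>2 + x) \<ge> y\<^sup>2 / (100 * (t\<^sup>2 + y\<^sup>2))"
    proof -
      have "D\<^sup>2 \<le> (2 * t)\<^sup>2" using D by (intro power_mono) auto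
      then have D2: "D\<^sup>2 \<le> 4 * t\<^sup>2" by (simp add: power_mult_distrib)
      have "y\<^sup>2 * (D\<^sup>2 + x) = y\<^sup>2 * D\<^sup>2 + y\<^sup>2 * x" by (simp add: algebra_simps)
      also have "\<dots> \<le> (25 * x) * (4 * t\<^sup>2) + y\<^sup>2 * x"
        using x D2 x0 by (intro add_mono mult_mono) auto
      also have "\<dots> \<le> x * (100 * (t\<^sup>2 + y\<^sup>2))" using x0 by (simp add: algebra_simps)
      finally have "y\<^sup>2 * (D\<^sup>2 + x) \<le> x * (100 * (t\<^sup>2 + y\<^sup>2))" .
      moreover have "D\<^sup>2 + x > 0" using D x0 by (intro add_pos_nonneg) auto
      moreover have "100 * (t\<^sup>2 + y\<^sup>2) > 0" using t by (simp add: add_pos_nonneg)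
      ultimately show ?thesis by (simp add: divide_le_eq le_divide_eq field_simps)
    qed
    have "y\<^sup>2 / (600 * t * (t\<^sup>2 + y\<^sup>2)) = 1 / (6 * t) * (y\<^sup>2 / (100 * (t\<^sup>2 + y\<^sup>2)))" by simp
    also have "\<dots> \<le> r / D * (x / (D\<^sup>2 + x))"
      using rD 2 r D by (intro mult_mono) auto
    finally show ?thesis using 1 by linarith
  next
    case False
    have "cos y \<le> 0"
    proof -
      have "cos \<bar>y\<bar> \<le> cos (pi / 2)" using False y by (intro cos_monotone_0_pi_le) auto
      then show ?thesis by simp
    qed
    then have "r * cos y * D / (D\<^sup>2 + 4 * (r * sin y)\<^sup>2) \<le> 0"
      using r D by (intro divide_nonpos_nonneg mult_nonpos_nonneg mult_nonneg_nonpos) auto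
    then have "r / (1 - r\<^sup>2) - Re (q / (1 - q\<^sup>2)) \<ge> 1 / (6 * t)"
      unfolding Re using rD unfolding D_def by linarith
    moreover have "y\<^sup>2 / (600 * t * (t\<^sup>2 + y\<^sup>2)) \<le> 1 / (6 * t)"
      using t by (simp add: field_simps add_pos_nonneg)
    ultimately show ?thesis by linarith
  qed
qed

section \<open>Size of P near the positive real axis\<close>

definition growth :: "nat \<Rightarrow> real" where
  "growth a = pi\<^sup>2 / 12 + real a * pi\<^sup>2 / 24"

lemma growth_pos: "growth a > 0"
  by (simp add: growth_def add_pos_nonneg)

lemma growth_le: "a \<in> {1, 2} \<Longrightarrow> growth a \<le> 3"
proof -
  assume "a \<in> {1, 2}"
  moreover have "pi\<^sup>2 \<le> 4\<^sup>2" using pi_less_4 pi_gt_zero by (intro power_mono) auto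
  ultimately show ?thesis by (auto simp: growth_def)
qed

definition logP :: "nat \<Rightarrow> complex \<Rightarrow> complex" where
  "logP a z = of_nat a * logQ (2 * z) + logQ z"

lemma Pfun_conv_logP: "Pfun a z = exp (logP a z)"
  by (simp add: Pfun_def logP_def exp_add exp_of_nat_mult)

text \<open>One product at z gives pi^2/(12z) and each of the a products at 2z gives pi^2/(24z),
  together \<open>growth a\<close> over z; each of the a + 1 products contributes -log 2 / 2. The
  range Re z \<le> 1/2 keeps 2z within reach of \<open>logQ_asymp\<close>.\<close>

lemma logP_asymp:
  assumes z: "z \<in> sector" "Re z \<le> 1 / 2"
  shows "norm (logP a z - (of_real (growth a) / z - of_real (real (a + 1) * ln 2 / 2))) \<le> (16 + 32 * real a) * norm z"
proof -
  have z0: "z \<noteq> 0" using z by (auto simp: sector_def)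
  have L: "Ln 2 = complex_of_real (ln 2)" using Ln_of_real[of 2] by simp
  have 1: "norm (logQ z - (of_real (pi\<^sup>2 / 12) / z - Ln 2 / 2)) \<le> 16 * norm z"
    using z by (intro logQ_asymp) auto
  have "2 * z \<in> sector" using sector_mult[OF z(1), of 2] by simp
  then have 2: "norm (logQ (2 * z) - (of_real (pi\<^sup>2 / 12) / (2 * z) - Ln 2 / 2)) \<le> 16 * norm (2 * z)"
    using z by (intro logQ_asymp) auto
  have "logP a z - (of_real (growth a) / z - of_real (real (a + 1) * ln 2 / 2)) =
      of_nat a * (logQ (2 * z) - (of_real (pi\<^sup>2 / 12) / (2 * z) - Ln 2 / 2)) +
      (logQ z - (of_real (pi\<^sup>2 / 12) / z - Ln 2 / 2))"
    using z0 by (simp add: logP_def growth_def L field_simps)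
  also have "norm \<dots> \<le> real a * (16 * norm (2 * z)) + 16 * norm z"
    using 1 2 by (intro order.trans[OF norm_triangle_ineq] add_mono) (auto simp: norm_mult intro!: mult_left_mono)
  finally show ?thesis by (simp add: norm_mult algebra_simps)
qed

text \<open>The 40 is (16 + 32a)|z| at a = 2 and |z| = 1/2; the negative term with log 2 is
  dropped.\<close>

lemma norm_Pfun_real_le:
  assumes "0 < t" "t \<le> 1 / 2" "a \<in> {1, 2}"
  shows "norm (Pfun a (of_real t)) \<le> exp (growth a / t + 40)"
proof -
  define E where "E = logP a (of_real t) - (of_real (growth a) / of_real t - of_real (real (a + 1) * ln 2 / 2))"
  have "norm E \<le> (16 + 32 * real a) * norm (complex_of_real t)"
    unfolding E_def using assms by (intro logP_asymp) (auto simp: sector_def)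
  also have "\<dots> \<le> 80 * (1 / 2)" using assms by (intro mult_mono) auto
  finally have "Re E \<le> 40" using complex_Re_le_cmod[of E] by linarith
  moreover have "Re (logP a (of_real t)) = Re E + growth a / t - real (a + 1) * ln 2 / 2"
    by (simp add: E_def of_real_divide[symmetric] del: of_real_divide)
  moreover have "real (a + 1) * ln 2 / 2 \<ge> 0" by simp
  ultimately have "Re (logP a (of_real t)) \<le> growth a / t + 40" by linarith
  then show ?thesis by (simp add: Pfun_conv_logP)
qed

section \<open>Cauchy's formula on a vertical segment\<close>

lemma integral_cis_period:
  fixes m :: int
  assumes "m \<noteq> 0"
  shows "(LINT y|lborel. indicator {-pi..pi} y *\<^sub>R cis (real_of_int m * y)) = 0"
proof -
  define F where "F z = exp (\<i> * of_int m * z) / (\<i> * of_int m)" for z :: complex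
  have m: "\<i> * complex_of_int m \<noteq> 0" using assms by simp
  have "(F has_field_derivative exp (\<i> * of_int m * z)) (at z)" for z
    unfolding F_def using m by (auto intro!: derivative_eq_intros simp: field_simps)
  then have der: "((\<lambda>y. F (of_real y)) has_vector_derivative exp (\<i> * of_int m * of_real y)) (at y within A)" for y A
    by (intro has_vector_derivative_real_field)
  have cis: "cis (real_of_int m * y) = exp (\<i> * of_int m * of_real y)" for y
    by (simp add: cis_conv_exp mult.assoc)
  have "(LINT y|lborel. indicator {-pi..pi} y *\<^sub>R exp (\<i> * of_int m * of_real y)) = F (of_real pi) - F (of_real (- pi))"
    using pi_gt_zero by (intro integral_FTC_Icc der) (auto intro!: continuous_intros)
  also have "\<dots> = (cis (real_of_int m * pi) - cis (real_of_int m * (- pi))) / (\<i> * of_int m)"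
    unfolding F_def cis by (simp add: diff_divide_distrib)
  also have "cis (real_of_int m * pi) - cis (real_of_int m * (- pi)) = 0"
    by (simp add: complex_eq_iff sin_times_pi_eq_0)
  finally show ?thesis by (simp add: cis)
qed

lemma exp_Complex_power: "exp (- Complex t y) ^ k = of_real (exp (- t) ^ k) * cis (- (real k * y))"
proof -
  have "exp (- Complex t y) ^ k = exp (of_nat k * (- Complex t y))" by (rule exp_of_nat_mult[symmetric])
  also have "of_nat k * (- Complex t y) = of_real (real k * (- t)) + \<i> * of_real (- (real k * y))"
    by (simp add: complex_eq_iff)
  finally show ?thesis
    by (simp only: exp_add cis_conv_exp exp_of_real exp_of_nat_mult)
qed

text \<open>The power series is integrated term by term, which absolute summability at e^(-t)
  allows; only k = n survives the orthogonality of the exponentials.\<close>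

lemma circle_integral:
  assumes a: "a \<in> {1, 2}" and t: "0 < t"
  shows "integrable lborel (\<lambda>y. indicator {-pi..pi} y *\<^sub>R (Pfun a (Complex t y) * cis (real n * y)))"
    and "(LINT y|lborel. indicator {-pi..pi} y *\<^sub>R (Pfun a (Complex t y) * cis (real n * y))) =
      of_real (2 * pi * (real_of_int (pcoeff a n) * exp (- t) ^ n))"
proof -
  define c where "c k = real_of_int (pcoeff a k) * exp (- t) ^ k" for k
  define f where "f k y = indicator {-pi..pi} y *\<^sub>R (of_real (c k) * cis (real_of_int (int n - int k) * y))"
    for k and y :: real
  have trm: "of_int (pcoeff a k) * exp (- Complex t y) ^ k * cis (real n * y) =
      of_real (c k) * cis (real_of_int (int n - int k) * y)" for k y
    by (simp add: exp_Complex_power c_def cis_mult algebra_simps)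
  have f_sums: "(\<lambda>k. f k y) sums (indicator {-pi..pi} y *\<^sub>R (Pfun a (Complex t y) * cis (real n * y)))" for y
    unfolding f_def trm[symmetric]
    using t by (intro sums_scaleR_right sums_mult2 pcoeff_sums(2)[OF a]) simp
  have sc: "summable (\<lambda>k. \<bar>c k\<bar>)"
    using pcoeff_sums(1)[OF a, of "of_real t"] t
    by (simp add: c_def norm_mult norm_power abs_mult)
  have int: "integrable lborel (f k)" for k
    unfolding f_def by (intro borel_integrable_compact) (auto intro!: continuous_intros)
  have nf: "norm (f k y) = indicator {-pi..pi} y *\<^sub>R \<bar>c k\<bar>" for k y
    by (simp add: f_def norm_mult)
  have sn: "AE y in lborel. summable (\<lambda>k. norm (f k y))"
    unfolding nf by (intro AE_I2 summable_scaleR_right sc)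
  have si: "summable (\<lambda>k. LINT y|lborel. norm (f k y))"
    unfolding nf using sc by (simp add: summable_mult)
  have eq: "(\<Sum>k. f k y) = indicator {-pi..pi} y *\<^sub>R (Pfun a (Complex t y) * cis (real n * y))" for y
    using f_sums[of y] by (simp add: sums_iff)
  show "integrable lborel (\<lambda>y. indicator {-pi..pi} y *\<^sub>R (Pfun a (Complex t y) * cis (real n * y)))"
    using integrable_suminf[OF int sn si] unfolding eq .
  have "(\<lambda>k. integral\<^sup>L lborel (f k)) sums (LINT y|lborel. indicator {-pi..pi} y *\<^sub>R (Pfun a (Complex t y) * cis (real n * y)))"
    using sums_integral[OF int sn si] unfolding eq .
  moreover have "integral\<^sup>L lborel (f k) = (if k = n then of_real (2 * pi * c k) else 0)" for k
  proof -
    have "integral\<^sup>L lborel (f k) = of_real (c k) * (LINT y|lborel. indicator {-pi..pi} y *\<^sub>R cis (real_of_int (int n - int k) * y))"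
      unfolding f_def by (subst integral_mult_right_zero[symmetric]) (simp add: mult_ac)
    then show ?thesis using integral_cis_period[of "int n - int k"] by (auto simp: scaleR_conv_of_real)
  qed
  then have "(\<lambda>k. integral\<^sup>L lborel (f k)) sums of_real (2 * pi * c n)"
    using sums_single[of n "\<lambda>k. complex_of_real (2 * pi * c k)"] by simp
  ultimately show "(LINT y|lborel. indicator {-pi..pi} y *\<^sub>R (Pfun a (Complex t y) * cis (real n * y))) =
      of_real (2 * pi * (real_of_int (pcoeff a n) * exp (- t) ^ n))"
    unfolding c_def by (rule sums_unique2)
qed

text \<open>The integrand is a multiple of the normal density with variance 1/(2A), whose mass is
  1.\<close>

lemma gaussian_integral:
  assumes "A > 0"
  shows "(LINT v|lborel. exp (- A * v\<^sup>2)) = sqrt (pi / A)"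
proof -
  define s where "s = sqrt (1 / (2 * A))"
  have s: "s\<^sup>2 = 1 / (2 * A)" using assms by (simp add: s_def)
  have s0: "s > 0" using assms by (simp add: s_def)
  have "normal_density 0 s v = 1 / sqrt (pi / A) * exp (- A * v\<^sup>2)" for v
    unfolding normal_density_def s using assms by (simp add: field_simps)
  then have "(LINT v|lborel. normal_density 0 s v) = (LINT v|lborel. 1 / sqrt (pi / A) * exp (- A * v\<^sup>2))"
    by (simp only:)
  then have "1 / sqrt (pi / A) * (LINT v|lborel. exp (- A * v\<^sup>2)) = 1"
    unfolding integral_normal_density[OF s0] integral_mult_right_zero by (rule sym)
  then have "sqrt (pi / A) * (1 / sqrt (pi / A) * (LINT v|lborel. exp (- A * v\<^sup>2))) = sqrt (pi / A)"
    by (simp only: mult_1_right)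
  moreover have "sqrt (pi / A) \<noteq> 0" using assms by simp
  ultimately show ?thesis by (simp only: mult.assoc[symmetric] times_divide_eq_right mult_1_right divide_self mult_1_left simp_thms)
qed

lemma integrable_inverse_one_plus_square: "integrable lborel (\<lambda>v::real. inverse (1 + v\<^sup>2))"
  using integrable_inverse_1_plus_square by (simp add: set_integrable_def)

text \<open>One integrable majorant for all t. The condition v^2 t^3 \<le> pi^2 says |y| \<le> pi
  for y = t^(3/2) v. Where t v^2 \<le> 1 the exponent is at least c v^2/2; beyond, it is only known
  to be at least c/(2t), but v^2 \<le> pi^2/t^3, so the third power of the exponent controls
  v^2.\<close>

lemma exp_gain_le:
  fixes c :: real
  assumes c: "0 < c" "c \<le> 1"
  shows "\<exists>K>0. \<forall>v t. 0 < t \<longrightarrow> t \<le> 1 \<longrightarrow> v\<^sup>2 * t ^ 3 \<le> pi\<^sup>2 \<longrightarrow> exp (- (c * (v\<^sup>2 / (1 + t * v\<^sup>2)))) \<le> K * inverse (1 + v\<^sup>2)"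
proof -
  \<comment> \<open>432 = 2 * 27 * 8: the 27 and the 8 come from e^x \<ge> (x/3)^3 at x = c/(2t),
    the 2 from 1 + v^2 \<le> 2 v^2.\<close>
  define b where "b = min (c / 2) (c ^ 3 / (432 * pi\<^sup>2))"
  have b: "b > 0" using c by (simp add: b_def)
  have "exp (- (c * (v\<^sup>2 / (1 + t * v\<^sup>2)))) \<le> (1 / b) * inverse (1 + v\<^sup>2)" if t: "0 < t" "t \<le> 1" and v: "v\<^sup>2 * t ^ 3 \<le> pi\<^sup>2" for v t :: real
  proof -
    define U where "U = v\<^sup>2 / (1 + t * v\<^sup>2)"
    have pos: "1 + t * v\<^sup>2 > 0" using t by (simp add: add_pos_nonneg)
    have U0: "U \<ge> 0" using pos by (simp add: U_def)
    have "b * (1 + v\<^sup>2) \<le> exp (c * U)"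
    proof (cases "t * v\<^sup>2 \<le> 1")
      case True
      have "v\<^sup>2 / 2 \<le> U" unfolding U_def using True pos by (intro divide_left_mono) auto
      then have "c * (v\<^sup>2 / 2) \<le> c * U" using c by simp
      moreover have "b * (1 + v\<^sup>2) \<le> c / 2 * (1 + v\<^sup>2)" by (intro mult_right_mono) (auto simp: b_def)
      moreover have "c / 2 * (1 + v\<^sup>2) = c / 2 + c * (v\<^sup>2 / 2)" by (simp add: algebra_simps)
      ultimately have "b * (1 + v\<^sup>2) \<le> 1 + c * U" using c by linarith
      then show ?thesis using exp_ge_add_one_self[of "c * U"] by linarith
    next
      case False
      then have tv: "1 < t * v\<^sup>2" by simp
      have "1 / (2 * t) \<le> U"
      proof -
        have "1 + t * v\<^sup>2 \<le> v\<^sup>2 * (2 * t)" using tv by (simp add: algebra_simps)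
        then show ?thesis unfolding U_def using pos t by (simp add: field_simps)
      qed
      then have "(c * (1 / (2 * t))) ^ 3 \<le> (c * U) ^ 3" using c t by (intro power_mono mult_left_mono) auto
      moreover have "(c * U) ^ 3 / 27 \<le> exp (c * U)"
      proof -
        have "(c * U / 3) ^ 3 \<le> exp (c * U / 3) ^ 3"
        proof (rule power_mono)
          show "c * U / 3 \<le> exp (c * U / 3)" using exp_ge_add_one_self[of "c * U / 3"] by linarith
        qed (use U0 c in auto)
        also have "\<dots> = exp (c * U)" by (simp add: exp_of_nat_mult[symmetric])
        finally show ?thesis by (simp add: power_divide)
      qed
      moreover have "b * (1 + v\<^sup>2) \<le> (c * (1 / (2 * t))) ^ 3 / 27"
      proof -
        have "t * v\<^sup>2 \<le> 1 * v\<^sup>2" using t by (intro mult_right_mono) auto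
        then have "v\<^sup>2 \<ge> 1" using tv by simp
        then have "b * (1 + v\<^sup>2) \<le> c ^ 3 / (432 * pi\<^sup>2) * (2 * v\<^sup>2)"
          using c by (intro mult_mono) (auto simp: b_def)
        also have "\<dots> = c ^ 3 / (216 * pi\<^sup>2 * t ^ 3) * (v\<^sup>2 * t ^ 3)" using t by (simp add: field_simps)
        also have "\<dots> \<le> c ^ 3 / (216 * pi\<^sup>2 * t ^ 3) * pi\<^sup>2" using c t v by (intro mult_left_mono) auto
        also have "\<dots> = (c * (1 / (2 * t))) ^ 3 / 27" using t by (simp add: field_simps)
        finally show ?thesis .
      qed
      ultimately show ?thesis by linarith
    qed
    then have "exp (- (c * U)) \<le> inverse (b * (1 + v\<^sup>2))"
      unfolding exp_minus using b by (intro le_imp_inverse_le mult_pos_pos) (auto intro: add_pos_nonneg)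
    then show ?thesis unfolding U_def by (simp add: inverse_eq_divide)
  qed
  then show ?thesis using b by (intro exI[of _ "1 / b"]) auto
qed

lemma norm_Pfun_le_gain:
  assumes a: "a \<in> {1, 2}" and t: "0 < t" "t \<le> 1 / 2" and y: "\<bar>y\<bar> \<le> pi"
  shows "norm (Pfun a (Complex t y)) \<le> exp (growth a / t + 40) * exp (- (1 / 2400 * (y\<^sup>2 / (t * (t\<^sup>2 + y\<^sup>2)))))"
proof -
  have "norm (Pfun a (Complex t y)) \<le> norm (Pfun a (of_real t)) *
      exp (- ((exp (- t) / (1 - (exp (- t))\<^sup>2) - Re (exp (- Complex t y) / (1 - (exp (- Complex t y))\<^sup>2))) / 4))"
    using norm_Pfun_le[of "Complex t y" a] t by simp
  also have "\<dots> \<le> exp (growth a / t + 40) * exp (- (1 / 2400 * (y\<^sup>2 / (t * (t\<^sup>2 + y\<^sup>2)))))"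
  proof (intro mult_mono norm_Pfun_real_le t a)
    \<comment> \<open>2400 = 4 * 600: the quarter in \<open>norm_Pfun_le\<close> and the constant of
      \<open>gain_ge\<close>.\<close>
    have "1 / 2400 * (y\<^sup>2 / (t * (t\<^sup>2 + y\<^sup>2))) = y\<^sup>2 / (600 * t * (t\<^sup>2 + y\<^sup>2)) / 4" by simp
    then show "exp (- ((exp (- t) / (1 - (exp (- t))\<^sup>2) - Re (exp (- Complex t y) / (1 - (exp (- Complex t y))\<^sup>2))) / 4))
      \<le> exp (- (1 / 2400 * (y\<^sup>2 / (t * (t\<^sup>2 + y\<^sup>2)))))"
      using gain_ge[of t y] t y by simp
  qed auto
  finally show ?thesis .
qed

text \<open>With s = i v sqrt t one has z = t (1 + s), and the left side is (A/t)(1/(1+s) - 1 + s).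
  The choice n = A/t^2 makes t a saddle point: the linear term cancels and exactly (A/t) s^2/(1+s)
  remains. On the scale t^(3/2) this has the finite limit -A v^2.\<close>

lemma saddle_exponent:
  fixes t v A :: real and z :: complex
  assumes t: "0 < t"
  defines "w \<equiv> sqrt t"
  defines "z \<equiv> Complex t (t * w * v)"
  shows "of_real A / z - of_real (A / t) + \<i> * of_real (A / t\<^sup>2 * (t * w * v)) =
    - of_real (A * v\<^sup>2) / (1 + \<i> * of_real (v * w))"
proof -
  define s where "s = \<i> * complex_of_real (v * w)"
  have w2: "w * w = t" using t by (simp add: w_def)
  have s1: "1 + s \<noteq> 0" by (auto simp: s_def complex_eq_iff)
  have z: "z = of_real t * (1 + s)" by (simp add: z_def s_def complex_eq_iff)
  have "\<i> * complex_of_real (A / t\<^sup>2 * (t * w * v)) = of_real (A / t) * s"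
    using t by (simp add: s_def power2_eq_square)
  moreover have "of_real A / z = of_real (A / t) * (1 / (1 + s))" using t by (simp add: z)
  ultimately have "of_real A / z - of_real (A / t) + \<i> * of_real (A / t\<^sup>2 * (t * w * v)) =
      of_real (A / t) * (1 / (1 + s) - 1 + s)"
    by (simp only:) (simp add: algebra_simps)
  also have "1 / (1 + s) - 1 + s = s * s / (1 + s)" using s1 by (simp add: field_simps)
  also have "s * s = - of_real (v\<^sup>2 * t)"
  proof -
    have "s * s = - of_real (v\<^sup>2 * (w * w))" by (simp add: s_def power2_eq_square mult_ac)
    then show ?thesis by (simp only: w2)
  qed
  also have "of_real (A / t) * (- of_real (v\<^sup>2 * t) / (1 + s)) = - complex_of_real (A * v\<^sup>2) / (1 + s)"
    using t by (simp add: field_simps)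
  finally show ?thesis by (simp only: s_def)
qed

lemma pcoeff_integral_tendsto:
  assumes a: "a \<in> {1, 2}"
  defines "A \<equiv> growth a"
  defines "t \<equiv> \<lambda>n::nat. sqrt (A / real n)"
  shows "(\<lambda>n. exp (- 2 * (A / t n)) / (t n * sqrt (t n)) * (2 * pi * real_of_int (pcoeff a n)))
    \<longlonglongrightarrow> exp (- (real (a + 1) * ln 2 / 2)) * sqrt (pi / A)"
proof -
  have A: "0 < A" "A \<le> 3" using growth_pos growth_le[OF a] by (auto simp: A_def)
  define w where "w n = sqrt (t n)" for n
  \<comment> \<open>The rescaled integrand, zero beyond |y| = pi and divided by e^(A/t), the
    exponential order of P at the saddle point. A second factor e^(-A/t) comes from e^(-nt).\<close>
  define W where "W n v = exp (- (A / t n)) *\<^sub>R (indicator {-pi..pi} (t n * w n * v) *\<^sub>R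
      (Pfun a (Complex (t n) (t n * w n * v)) * cis (real n * (t n * w n * v))))" for n :: nat and v :: real
  define C where "C = exp (- (real (a + 1) * ln 2 / 2))"
  have tpos: "0 < t n" if "n \<ge> 12" for n using that A by (simp add: t_def)
  have t2: "(t n)\<^sup>2 = A / real n" for n using A by (simp add: t_def)
  \<comment> \<open>From n = 12 on, A \<le> 3 gives t^2 \<le> 1/4, so t lies in the range of the
    estimates for P.\<close>
  have tle: "t n \<le> 1 / 2" if "n \<ge> 12" for n
  proof (rule power2_le_imp_le)
    show "(t n)\<^sup>2 \<le> (1 / 2)\<^sup>2" unfolding t2 using that A by (simp add: power2_eq_square field_simps)
  qed simp
  have nt: "real n = A / (t n)\<^sup>2" if "n \<ge> 12" for n unfolding t2 using that A by simp
  have t0: "t \<longlonglongrightarrow> 0"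
  proof -
    have "(\<lambda>n. sqrt (A * (1 / real n))) \<longlonglongrightarrow> sqrt (A * 0)" by (intro tendsto_intros lim_1_over_n)
    then show ?thesis by (simp add: t_def)
  qed
  then have w0: "w \<longlonglongrightarrow> 0" unfolding w_def using tendsto_real_sqrt[OF t0] by simp
  obtain K where K: "K > 0" "\<And>v t. 0 < t \<Longrightarrow> t \<le> 1 \<Longrightarrow> v\<^sup>2 * t ^ 3 \<le> pi\<^sup>2 \<Longrightarrow>
      exp (- (1 / 2400 * (v\<^sup>2 / (1 + t * v\<^sup>2)))) \<le> K * inverse (1 + v\<^sup>2)"
    using exp_gain_le[of "1 / 2400"] by auto
  have int_W: "integrable lborel (W n)"
    "(LINT v|lborel. W n v) = of_real (exp (- 2 * (A / t n)) / (t n * w n) * (2 * pi * real_of_int (pcoeff a n)))"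
    if n: "n \<ge> 12" for n
  proof -
    have tn: "0 < t n" "t n * w n \<noteq> 0" "0 < t n * w n" using tpos[OF n] by (auto simp: w_def)
    define g where "g y = indicator {-pi..pi} y *\<^sub>R (Pfun a (Complex (t n) y) * cis (real n * y))" for y
    note ci = circle_integral[OF a tn(1), of n, folded g_def]
    have W: "W n = (\<lambda>v. exp (- (A / t n)) *\<^sub>R g (0 + t n * w n * v))" by (auto simp: W_def g_def)
    have "integrable lborel (\<lambda>v. g (0 + t n * w n * v))"
      using ci(1) tn(2) by (subst lborel_integrable_real_affine_iff) auto
    then show "integrable lborel (W n)" unfolding W by (rule integrable_scaleR_right)
    have "integral\<^sup>L lborel g = \<bar>t n * w n\<bar> *\<^sub>R (LINT v|lborel. g (0 + t n * w n * v))"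
      by (rule lborel_integral_real_affine[OF tn(2)])
    then have "(LINT v|lborel. g (0 + t n * w n * v)) = (1 / (t n * w n)) *\<^sub>R integral\<^sup>L lborel g"
      using tn(2,3) by simp
    then have "(LINT v|lborel. W n v) =
        of_real (exp (- (A / t n)) * (1 / (t n * w n) * (2 * pi * (real_of_int (pcoeff a n) * exp (- t n) ^ n))))"
      unfolding W integral_scaleR_right ci(2) by (simp add: scaleR_conv_of_real)
    also have "exp (- t n) ^ n = exp (- (A / t n))"
    proof -
      have "exp (- t n) ^ n = exp (real n * (- t n))" by (rule exp_of_nat_mult[symmetric])
      also have "real n * (- t n) = - (A / t n)" using tn by (subst nt[OF n]) (simp add: power2_eq_square)
      finally show ?thesis .
    qed
    also have "exp (- (A / t n)) * (1 / (t n * w n) * (2 * pi * (real_of_int (pcoeff a n) * exp (- (A / t n))))) =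
        (exp (- (A / t n)) * exp (- (A / t n))) / (t n * w n) * (2 * pi * real_of_int (pcoeff a n))"
      by simp
    also have "exp (- (A / t n)) * exp (- (A / t n)) = exp (- 2 * (A / t n))"
      by (simp add: exp_add[symmetric])
    finally show "(LINT v|lborel. W n v) = of_real (exp (- 2 * (A / t n)) / (t n * w n) * (2 * pi * real_of_int (pcoeff a n)))" .
  qed
  \<comment> \<open>Valid for every v, so the far part of the circle needs no separate estimate. In
    the variable v the exponent of \<open>norm_Pfun_le_gain\<close> becomes v^2/(1 + t v^2), up to
    the factor 1/2400.\<close>
  have bound: "norm (W n v) \<le> exp 40 * K * inverse (1 + v\<^sup>2)" if n: "n \<ge> 12" for n v
  proof (cases "\<bar>t n * w n * v\<bar> \<le> pi")
    case False
    then have "W n v = 0" by (auto simp: W_def indicator_def)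
    then show ?thesis using K(1) by (simp add: add_nonneg_nonneg)
  next
    case True
    define y where "y = t n * w n * v"
    have tn: "0 < t n" "t n \<le> 1 / 2" using tpos[OF n] tle[OF n] by auto
    have y2: "y\<^sup>2 = (t n) ^ 3 * v\<^sup>2"
      using tn by (simp add: y_def w_def power_mult_distrib power2_eq_square[of "t n"] power3_eq_cube)
    have "norm (W n v) \<le> exp (- (A / t n)) * norm (Pfun a (Complex (t n) y))"
      by (simp add: W_def norm_mult y_def indicator_def)
    also have "\<dots> \<le> exp (- (A / t n)) * (exp (A / t n + 40) * exp (- (1 / 2400 * (y\<^sup>2 / (t n * ((t n)\<^sup>2 + y\<^sup>2))))))"
      using norm_Pfun_le_gain[OF a tn, of y] True unfolding A_def y_def by (intro mult_left_mono) auto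
    also have "\<dots> = exp 40 * exp (- (1 / 2400 * (y\<^sup>2 / (t n * ((t n)\<^sup>2 + y\<^sup>2)))))"
      by (simp add: exp_add[symmetric] mult.assoc[symmetric])
    also have "y\<^sup>2 / (t n * ((t n)\<^sup>2 + y\<^sup>2)) = v\<^sup>2 / (1 + t n * v\<^sup>2)"
    proof -
      have "t n * ((t n)\<^sup>2 + y\<^sup>2) = (t n) ^ 3 * (1 + t n * v\<^sup>2)"
        unfolding y2 by (simp add: algebra_simps power2_eq_square power3_eq_cube)
      then show ?thesis using tn unfolding y2 by simp
    qed
    also have "exp 40 * exp (- (1 / 2400 * (v\<^sup>2 / (1 + t n * v\<^sup>2)))) \<le> exp 40 * (K * inverse (1 + v\<^sup>2))"
    proof (intro mult_left_mono K(2))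
      have "\<bar>y\<bar>\<^sup>2 \<le> pi\<^sup>2" using True unfolding y_def by (intro power_mono) auto
      then show "v\<^sup>2 * (t n) ^ 3 \<le> pi\<^sup>2" using y2 by (simp add: mult.commute)
    qed (use tn in auto)
    finally show ?thesis by simp
  qed
  have lim: "(\<lambda>n. W n v) \<longlonglongrightarrow> of_real (C * exp (- A * v\<^sup>2))" for v
  proof -
    define z where "z n = Complex (t n) (t n * w n * v)" for n
    define E where "E n = logP a (z n) - (of_real A / z n - of_real (real (a + 1) * ln 2 / 2))" for n
    have wv: "(\<lambda>n. v * w n) \<longlonglongrightarrow> 0" using tendsto_mult_right_zero[OF w0] .
    have y0: "(\<lambda>n. t n * w n * v) \<longlonglongrightarrow> 0" using tendsto_mult_left_zero[OF tendsto_mult_zero[OF t0 w0]] .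
    have z0: "z \<longlonglongrightarrow> 0" using tendsto_Complex[OF t0 y0] by (simp add: z_def[abs_def] zero_complex.code)
    have ev1: "\<forall>\<^sub>F n in sequentially. \<bar>v * w n\<bar> < 1"
      using order_tendstoD(2)[OF tendsto_rabs_zero[OF wv], of 1] by simp
    have ev2: "\<forall>\<^sub>F n in sequentially. \<bar>t n * w n * v\<bar> < pi"
      using order_tendstoD(2)[OF tendsto_rabs_zero[OF y0], of pi] by simp
    \<comment> \<open>For fixed v the point z eventually lies in the sector, because Im z / Re z = v
      sqrt t tends to 0.\<close>
    have E0: "E \<longlonglongrightarrow> 0"
    proof (rule Lim_null_comparison)
      show "\<forall>\<^sub>F n in sequentially. norm (E n) \<le> (16 + 32 * real a) * norm (z n)"
        using ev1 eventually_ge_at_top[of 12]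
      proof eventually_elim
        case (elim n)
        have "\<bar>t n * w n * v\<bar> = t n * \<bar>v * w n\<bar>" using tpos[OF elim(2)] by (simp add: abs_mult)
        also have "\<dots> \<le> t n * 1" using elim tpos[OF elim(2)] by (intro mult_left_mono) auto
        finally have "z n \<in> sector" using tpos[OF elim(2)] by (auto simp: sector_def z_def)
        then show ?case unfolding E_def A_def using tle[OF elim(2)] by (intro logP_asymp) (auto simp: z_def)
      qed
      show "(\<lambda>n. (16 + 32 * real a) * norm (z n)) \<longlonglongrightarrow> 0"
        by (intro tendsto_mult_right_zero tendsto_norm_zero z0)
    qed
    have L: "(\<lambda>n. exp (E n - of_real (real (a + 1) * ln 2 / 2) + (- of_real (A * v\<^sup>2) / (1 + \<i> * of_real (v * w n)))))
        \<longlonglongrightarrow> exp (0 - of_real (real (a + 1) * ln 2 / 2) + (- of_real (A * v\<^sup>2) / (1 + \<i> * of_real 0)))"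
      by (intro tendsto_intros E0 wv) auto
    have R: "exp (0 - of_real (real (a + 1) * ln 2 / 2) + (- of_real (A * v\<^sup>2) / (1 + \<i> * of_real 0))) =
        complex_of_real (C * exp (- A * v\<^sup>2))"
      unfolding C_def exp_add[symmetric] exp_of_real[symmetric] by simp
    show ?thesis
    proof (rule Lim_transform_eventually[OF L[unfolded R]])
      show "\<forall>\<^sub>F n in sequentially. exp (E n - of_real (real (a + 1) * ln 2 / 2) + (- of_real (A * v\<^sup>2) / (1 + \<i> * of_real (v * w n)))) = W n v"
        using ev2 eventually_ge_at_top[of 12]
      proof eventually_elim
        case (elim n)
        have "W n v = exp (of_real (- (A / t n))) * (exp (logP a (z n)) * exp (\<i> * of_real (real n * (t n * w n * v))))"
        proof -
          have "indicator {-pi..pi} (t n * w n * v) = (1::real)" using elim by (auto simp: indicator_def)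
          then show ?thesis
            by (simp only: W_def z_def Pfun_conv_logP scaleR_conv_of_real exp_of_real cis_conv_exp of_real_1 mult_1_left)
        qed
        also have "\<dots> = exp (logP a (z n) - of_real (A / t n) + \<i> * of_real (real n * (t n * w n * v)))"
          by (simp add: exp_add[symmetric] algebra_simps)
        also have "logP a (z n) - of_real (A / t n) + \<i> * of_real (real n * (t n * w n * v)) =
            E n - of_real (real (a + 1) * ln 2 / 2) +
            (of_real A / z n - of_real (A / t n) + \<i> * of_real (A / (t n)\<^sup>2 * (t n * w n * v)))"
          unfolding E_def nt[OF elim(2), symmetric] by simp
        also have "of_real A / z n - of_real (A / t n) + \<i> * of_real (A / (t n)\<^sup>2 * (t n * w n * v)) =
            - of_real (A * v\<^sup>2) / (1 + \<i> * of_real (v * w n))"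
          unfolding z_def w_def by (rule saddle_exponent[OF tpos[OF elim(2)]])
        finally show ?case by simp
      qed
    qed
  qed
  \<comment> \<open>The shift by 12 makes the domination and the integrability hold for every
    index.\<close>
  have "(\<lambda>n. LINT v|lborel. W (n + 12) v) \<longlonglongrightarrow> (LINT v|lborel. complex_of_real (C * exp (- A * v\<^sup>2)))"
  proof (rule integral_dominated_convergence)
    show "integrable lborel (\<lambda>v. exp 40 * K * inverse (1 + v\<^sup>2))"
      by (intro integrable_mult_right integrable_inverse_one_plus_square)
    show "AE v in lborel. (\<lambda>n. W (n + 12) v) \<longlonglongrightarrow> complex_of_real (C * exp (- A * v\<^sup>2))"
      by (intro AE_I2 LIMSEQ_ignore_initial_segment lim)
    show "W (n + 12) \<in> borel_measurable lborel" for n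
      using int_W(1)[of "n + 12"] by auto
    show "AE v in lborel. norm (W (n + 12) v) \<le> exp 40 * K * inverse (1 + v\<^sup>2)" for n
      by (intro AE_I2 bound) simp
  qed auto
  also have "(LINT v|lborel. complex_of_real (C * exp (- A * v\<^sup>2))) = of_real (C * sqrt (pi / A))"
    using gaussian_integral[OF A(1)] by (simp only: integral_complex_of_real integral_mult_right_zero)
  also have "(\<lambda>n. LINT v|lborel. W (n + 12) v) =
      (\<lambda>n. complex_of_real (exp (- 2 * (A / t (n + 12))) / (t (n + 12) * w (n + 12)) * (2 * pi * real_of_int (pcoeff a (n + 12)))))"
    by (intro ext int_W(2)) simp
  finally have "(\<lambda>n. exp (- 2 * (A / t (n + 12))) / (t (n + 12) * w (n + 12)) * (2 * pi * real_of_int (pcoeff a (n + 12))))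
      \<longlonglongrightarrow> C * sqrt (pi / A)"
    by (simp only: tendsto_of_real_iff)
  then show ?thesis unfolding C_def w_def by (rule LIMSEQ_offset)
qed

section \<open>Asymptotics of the coefficients\<close>

text \<open>The first factor is 2^(-(a+1)/2), the root is the Gaussian integral, 2 pi is the length
  of the period, and the power 3/4 of \<open>growth a\<close> comes from t^(3/2) =
  (A/n)^(3/4).\<close>

definition Pconst :: "nat \<Rightarrow> real" where
  "Pconst a = exp (- (real (a + 1) * ln 2 / 2)) * sqrt (pi / growth a) * growth a powr (3 / 4) / (2 * pi)"

lemma pcoeff_over_tendsto:
  assumes a: "a \<in> {1, 2}"
  shows "(\<lambda>n. real_of_int (pcoeff a n) / (real n powr (- 3 / 4) * exp (2 * sqrt (growth a * real n)))) \<longlonglongrightarrow> Pconst a"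
proof -
  define A where "A = growth a"
  have A: "A > 0" unfolding A_def by (rule growth_pos)
  define t where "t n = sqrt (A / real n)" for n :: nat
  define s where "s n = exp (- 2 * (A / t n)) / (t n * sqrt (t n)) * (2 * pi * real_of_int (pcoeff a n))" for n
  have "s \<longlonglongrightarrow> exp (- (real (a + 1) * ln 2 / 2)) * sqrt (pi / A)"
    unfolding s_def t_def A_def by (rule pcoeff_integral_tendsto[OF a])
  then have "(\<lambda>n. s n * (A powr (3 / 4) / (2 * pi))) \<longlonglongrightarrow> exp (- (real (a + 1) * ln 2 / 2)) * sqrt (pi / A) * (A powr (3 / 4) / (2 * pi))"
    by (intro tendsto_intros)
  moreover have "\<forall>\<^sub>F n in sequentially. s n * (A powr (3 / 4) / (2 * pi)) =
      real_of_int (pcoeff a n) / (real n powr (- 3 / 4) * exp (2 * sqrt (A * real n)))"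
    using eventually_gt_at_top[of 0]
  proof eventually_elim
    case (elim n)
    have An: "A / real n > 0" using elim A by simp
    have t: "t n = (A / real n) powr (1 / 2)" unfolding t_def using An by (simp add: powr_half_sqrt)
    have "sqrt (t n) = (t n) powr (1 / 2)" using An by (simp add: powr_half_sqrt t_def)
    also have "\<dots> = (A / real n) powr (1 / 4)" unfolding t by (simp add: powr_powr)
    finally have "t n * sqrt (t n) = (A / real n) powr (1 / 2 + 1 / 4)" unfolding t powr_add by simp
    also have "\<dots> = A powr (3 / 4) / real n powr (3 / 4)" using elim A by (simp add: powr_divide)
    finally have 1: "t n * sqrt (t n) = A powr (3 / 4) / real n powr (3 / 4)" .
    have "A / t n = sqrt (A * real n)"
    proof -
      have "A / t n = A / sqrt A * sqrt (real n)" by (simp add: t_def real_sqrt_divide)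
      also have "A / sqrt A = sqrt A" using A by (simp add: real_div_sqrt)
      finally show ?thesis by (simp add: real_sqrt_mult)
    qed
    then have 2: "exp (- 2 * (A / t n)) = 1 / exp (2 * sqrt (A * real n))"
      by (simp add: exp_minus inverse_eq_divide)
    have 3: "real n powr (- 3 / 4) = 1 / real n powr (3 / 4)"
      using powr_minus[of "real n" "3 / 4"] by (simp add: inverse_eq_divide)
    show ?case unfolding s_def 1 2 3 using A elim by (simp add: field_simps)
  qed
  ultimately have "(\<lambda>n. real_of_int (pcoeff a n) / (real n powr (- 3 / 4) * exp (2 * sqrt (A * real n))))
      \<longlonglongrightarrow> exp (- (real (a + 1) * ln 2 / 2)) * sqrt (pi / A) * (A powr (3 / 4) / (2 * pi))"
    by (rule Lim_transform_eventually)
  then show ?thesis by (simp add: Pconst_def A_def)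
qed

text \<open>Both hypotheses of \<open>ucoeff_over_pcoeff_tendsto\<close> are inherited from the
  comparison function g, which tends to infinity with consecutive ratios tending to 1.\<close>

lemma ucoeff_over_tendsto:
  assumes a: "a \<in> {1, 2}"
  shows "(\<lambda>n. real_of_int (ucoeff a n) / (real n powr (- 3 / 4) * exp (2 * sqrt (growth a * real n))))
    \<longlonglongrightarrow> Pconst a / real (a + 1)"
proof -
  define A where "A = growth a"
  have A: "A > 0" unfolding A_def by (rule growth_pos)
  define g where "g n = real n powr (- 3 / 4) * exp (2 * sqrt (A * real n))" for n :: nat
  define P where "P n = real_of_int (pcoeff a n)" for n
  have lim: "(\<lambda>n. P n / g n) \<longlonglongrightarrow> Pconst a"
    unfolding P_def g_def A_def by (rule pcoeff_over_tendsto[OF a])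
  have c: "Pconst a > 0" using growth_pos[of a] by (simp add: Pconst_def)
  have g_top: "filterlim g at_top at_top" unfolding g_def[abs_def] using A by real_asymp
  have g_ratio: "(\<lambda>n. g (Suc n) / g n) \<longlonglongrightarrow> 1" unfolding g_def[abs_def] using A by real_asymp
  have g_pos: "\<forall>\<^sub>F n in sequentially. g n > 0"
    using eventually_gt_at_top[of 0] by eventually_elim (simp add: g_def)
  have "filterlim (\<lambda>n. P n / g n * g n) at_top at_top"
    by (rule filterlim_tendsto_pos_mult_at_top[OF lim c g_top])
  moreover have "\<forall>\<^sub>F n in sequentially. P n / g n * g n = P n"
    using g_pos by eventually_elim simp
  ultimately have P_top: "filterlim P at_top at_top" by (simp cong: filterlim_cong)
  then have P_pos: "\<forall>\<^sub>F n in sequentially. P n > 0" unfolding filterlim_at_top_dense by blast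
  have "(\<lambda>n. (P (Suc n) / g (Suc n)) / (P n / g n) * (g (Suc n) / g n)) \<longlonglongrightarrow> Pconst a / Pconst a * 1"
    using c by (intro tendsto_intros LIMSEQ_Suc[OF lim] lim g_ratio) auto
  moreover have "\<forall>\<^sub>F n in sequentially. (P (Suc n) / g (Suc n)) / (P n / g n) * (g (Suc n) / g n) = P (Suc n) / P n"
    using g_pos eventually_sequentially_Suc[of "\<lambda>n. g n > 0", THEN iffD2, OF g_pos] P_pos
    by eventually_elim (simp add: field_simps)
  ultimately have P_ratio: "(\<lambda>n. P (Suc n) / P n) \<longlonglongrightarrow> 1"
    using c by (auto dest: Lim_transform_eventually)
  have "(\<lambda>n. real_of_int (ucoeff a n) / P n) \<longlonglongrightarrow> 1 / real (a + 1)"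
    using ucoeff_over_pcoeff_tendsto[OF a] P_top P_ratio unfolding P_def by blast
  from tendsto_mult[OF this lim]
  have "(\<lambda>n. real_of_int (ucoeff a n) / P n * (P n / g n)) \<longlonglongrightarrow> 1 / real (a + 1) * Pconst a" .
  moreover have "\<forall>\<^sub>F n in sequentially. real_of_int (ucoeff a n) / P n * (P n / g n) = real_of_int (ucoeff a n) / g n"
    using P_pos by eventually_elim simp
  ultimately have "(\<lambda>n. real_of_int (ucoeff a n) / g n) \<longlonglongrightarrow> 1 / real (a + 1) * Pconst a"
    by (rule Lim_transform_eventually)
  then show ?thesis by (simp add: g_def A_def)
qed

lemma ucoeff_asymp_equiv:
  assumes a: "a \<in> {1, 2}"
  assumes f: "\<And>n. n > 0 \<Longrightarrow> f n = Pconst a / real (a + 1) * (real n powr (- 3 / 4) * exp (2 * sqrt (growth a * real n)))"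
  shows "(\<lambda>n. real_of_int (ucoeff a n)) \<sim>[at_top] f"
proof (rule asymp_equivI')
  have c: "Pconst a / real (a + 1) > 0" using growth_pos[of a] by (simp add: Pconst_def)
  have L: "(\<lambda>n. real_of_int (ucoeff a n) / (real n powr (- 3 / 4) * exp (2 * sqrt (growth a * real n))) / (Pconst a / real (a + 1)))
    \<longlonglongrightarrow> (Pconst a / real (a + 1)) / (Pconst a / real (a + 1))"
    by (intro tendsto_divide ucoeff_over_tendsto[OF a] tendsto_const) (use c in auto)
  have E: "\<forall>\<^sub>F n in sequentially. real_of_int (ucoeff a n) / (real n powr (- 3 / 4) * exp (2 * sqrt (growth a * real n))) / (Pconst a / real (a + 1))
      = real_of_int (ucoeff a n) / f n"
    using eventually_gt_at_top[of 0] by eventually_elim (simp only: f divide_divide_eq_left mult.commute)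
  have "Pconst a / real (a + 1) / (Pconst a / real (a + 1)) = 1" using c by (metis divide_self less_irrefl)
  with Lim_transform_eventually[OF L E] show "(\<lambda>n. real_of_int (ucoeff a n) / f n) \<longlonglongrightarrow> 1"
    by (simp only:)
qed

text \<open>All powers of pi cancel: sqrt(b/pi) (pi^2/b)^(3/4) = pi b^(-1/4), against 2 pi in the
  denominator. In the two cases b is 8 and 6.\<close>

lemma Pconst_conv:
  assumes b: "growth a = pi\<^sup>2 / b" "b > 0"
  shows "Pconst a = exp (- (real (a + 1) * ln 2 / 2)) / (2 * b powr (1 / 4))"
proof -
  have "pi\<^sup>2 = pi powr 2" by simp
  then have p: "(pi\<^sup>2) powr x = pi powr (2 * x)" for x by (simp only: powr_powr)
  have "sqrt (pi / growth a) = sqrt (b / pi)" using b by (simp add: power2_eq_square)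
  also have "\<dots> = b powr (1 / 2) / pi powr (1 / 2)" using b by (simp add: powr_half_sqrt real_sqrt_divide)
  finally have "sqrt (pi / growth a) * growth a powr (3 / 4) =
      (b powr (1 / 2) / b powr (3 / 4)) * (pi powr (3 / 2) / pi powr (1 / 2))"
    using b by (simp add: powr_divide p)
  also have "\<dots> = b powr (- (1 / 4)) * pi" unfolding powr_diff[symmetric] by simp
  also have "\<dots> = pi / b powr (1 / 4)" by (simp add: powr_minus_divide)
  finally show ?thesis unfolding Pconst_def by (simp add: mult.assoc)
qed

lemma growth_1: "growth 1 = pi\<^sup>2 / 8" and growth_2: "growth 2 = pi\<^sup>2 / 6"
  by (simp_all add: growth_def)

lemma two_sqrt_conv: "x = (pi / 2)\<^sup>2 * y \<Longrightarrow> 2 * sqrt x = pi * sqrt y"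
  by (simp add: real_sqrt_mult)

theorem theorem1p2:
  shows "has_power_series_coeffs u2bar_term u2bar \<and>
         has_power_series_coeffs u2_term u2 \<and>
         (\<lambda>n. real_of_int (u2bar n)) \<sim>[at_top]
           (\<lambda>n. 1 / (8 * (2 * real n) powr (3 / 4)) * exp (pi * sqrt (real n / 2))) \<and>
         (\<lambda>n. real_of_int (u2 n)) \<sim>[at_top]
           (\<lambda>n. 1 / (4 * sqrt 3 * (6 * real n) powr (3 / 4)) * exp (pi * sqrt (2 * real n / 3)))"
proof (intro conjI)
  show "has_power_series_coeffs u2bar_term u2bar" "has_power_series_coeffs u2_term u2"
    unfolding u2bar_eq u2_eq by (rule has_power_series_coeffs_u2bar has_power_series_coeffs_u2)+
  have powr_neg: "real n powr (- 3 / 4) = 1 / real n powr (3 / 4)" for n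
    using powr_minus[of "real n" "3 / 4"] by (simp add: inverse_eq_divide)
  show "(\<lambda>n. real_of_int (u2bar n)) \<sim>[at_top]
           (\<lambda>n. 1 / (8 * (2 * real n) powr (3 / 4)) * exp (pi * sqrt (real n / 2)))"
    unfolding u2bar_eq
  proof (rule ucoeff_asymp_equiv)
    fix n :: nat assume n: "n > 0"
    \<comment> \<open>8^(1/4) = 2^(3/4) is the factor that the claim carries inside
      (2n)^(3/4).\<close>
    have "8 powr (1 / 4) = (2 powr 3) powr (1 / 4 :: real)" by simp
    also have "\<dots> = 2 powr (3 / 4)" unfolding powr_powr by simp
    finally have "Pconst 1 / real (1 + 1) = 1 / (8 * 2 powr (3 / 4))"
      unfolding Pconst_conv[OF growth_1 zero_less_numeral] by (simp add: exp_minus)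
    moreover have "2 * sqrt (growth 1 * real n) = pi * sqrt (real n / 2)"
      unfolding growth_1 by (rule two_sqrt_conv) (simp add: power_divide)
    ultimately show "1 / (8 * (2 * real n) powr (3 / 4)) * exp (pi * sqrt (real n / 2)) =
        Pconst 1 / real (1 + 1) * (real n powr (- 3 / 4) * exp (2 * sqrt (growth 1 * real n)))"
      by (simp only: powr_neg powr_mult) simp
  qed simp
  show "(\<lambda>n. real_of_int (u2 n)) \<sim>[at_top]
           (\<lambda>n. 1 / (4 * sqrt 3 * (6 * real n) powr (3 / 4)) * exp (pi * sqrt (2 * real n / 3)))"
    unfolding u2_eq
  proof (rule ucoeff_asymp_equiv)
    fix n :: nat assume n: "n > 0"
    have e: "exp (- (real (2 + 1) * ln 2 / 2)) = 1 / (2 * sqrt 2)"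
    proof -
      have "exp (- (real (2 + 1) * ln 2 / 2)) = 2 powr (- (1 + 1 / 2))" by (simp add: powr_def)
      also have "\<dots> = 1 / (2 * sqrt 2)"
        unfolding powr_minus_divide powr_add by (simp add: powr_half_sqrt)
      finally show ?thesis .
    qed
    \<comment> \<open>Matches 12 sqrt(2) 6^(1/4), the denominator that comes out, with 4 sqrt(3)
      6^(3/4), the one in the claim.\<close>
    have "6 powr (3 / 4) = 6 powr (1 / 2 + 1 / 4 :: real)" by simp
    also have "\<dots> = sqrt 2 * sqrt 3 * 6 powr (1 / 4)"
      unfolding powr_add by (simp add: powr_half_sqrt real_sqrt_mult[symmetric])
    finally have s: "4 * sqrt 3 * 6 powr (3 / 4) = 12 * sqrt 2 * 6 powr (1 / 4)" by simp
    have "Pconst 2 / real (2 + 1) = 1 / (4 * sqrt 3 * 6 powr (3 / 4))"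
      unfolding s Pconst_conv[OF growth_2 zero_less_numeral] e by simp
    moreover have "2 * sqrt (growth 2 * real n) = pi * sqrt (2 * real n / 3)"
      unfolding growth_2 by (rule two_sqrt_conv) (simp add: power_divide)
    ultimately show "1 / (4 * sqrt 3 * (6 * real n) powr (3 / 4)) * exp (pi * sqrt (2 * real n / 3)) =
        Pconst 2 / real (2 + 1) * (real n powr (- 3 / 4) * exp (2 * sqrt (growth 2 * real n)))"
      by (simp only: powr_neg powr_mult) simp
  qed simp
qed

end
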